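(* As $n \to \infty$, \[\operatorname{ssp}(K_n) = (1 + o(1))n.\]
   Context: For a graph $G$, a family $\mathcal{P}$ of paths in $G$ is strong-separating if for every ordered pair of distinct edges $e,f$ of $G$ there is a path in $\mathcal{P}$ containing $e$ but not $f$. $\operatorname{ssp}(G)$ denotes the minimum size of a strong-separating family of paths in $G$. $K_n$ is the complete graph on $n$ vertices. *)

theory Defs
  imports Main "HOL-Library.Landau_Symbols"
begin

definition Kn_edges :: "nat \<Rightarrow> nat set set" where
  "Kn_edges n = {e. \<exists>u v. u < n \<and> v < n \<and> u \<noteq> v \<and> e = {u, v}}"

text \<open>A path in K_n is a nonempty sequence of distinct vertices of K_n
(every pair of vertices is adjacent in K_n).\<close>

definition is_path_Kn :: "nat \<Rightarrow> nat list \<Rightarrow> bool" where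
  "is_path_Kn n xs \<longleftrightarrow> xs \<noteq> [] \<and> distinct xs \<and> set xs \<subseteq> {..<n}"

definition path_edges :: "nat list \<Rightarrow> nat set set" where
  "path_edges xs = {{xs ! i, xs ! Suc i} | i. Suc i < length xs}"

definition strong_separating_Kn :: "nat \<Rightarrow> nat list set \<Rightarrow> bool" where
  "strong_separating_Kn n P \<longleftrightarrow>
     (\<forall>p\<in>P. is_path_Kn n p) \<and>
     (\<forall>e\<in>Kn_edges n. \<forall>f\<in>Kn_edges n. e \<noteq> f \<longrightarrow>
        (\<exists>p\<in>P. e \<in> path_edges p \<and> f \<notin> path_edges p))"

definition ssp_Kn :: "nat \<Rightarrow> nat" where
  "ssp_Kn n = (LEAST k. \<exists>P. finite P \<and> card P = k \<and> strong_separating_Kn n P)"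

end

theory Submission
  imports Defs "HOL-Number_Theory.Number_Theory"
begin

text \<open>The lower bound is a double count: all but \<open>card P\<close> edges lie on at least two paths of a
  separating family \<open>P\<close>, and a path has at most \<open>n - 1\<close> edges.

  For the upper bound take \<open>n = N + card W\<close> with \<open>N\<close> coprime to 210 and \<open>card W\<close> a small fraction of
  \<open>n\<close>, and use as vertices the residues modulo \<open>N\<close> together with \<open>W\<close>. The \<open>N\<close> translates of one base
  path, built from edges between \<open>x\<close> and \<open>2 x\<close>, contain almost every edge exactly twice, and
  distinct edges lie on distinct pairs of translates: an edge between \<open>a\<close> and \<open>b\<close> lies on the
  translates by \<open>2 a - b\<close> and \<open>2 b - a\<close>, which determine \<open>a\<close> and \<open>b\<close>. The orbits of doubling
  are few and are linked to a single path through \<open>W\<close>. This spoils only a small set \<open>X\<close> of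
  differences, each of which is repaired by three further paths, and the edges inside \<open>W\<close> are
  separated recursively.\<close>

section \<open>Separating path families on arbitrary vertex sets\<close>

text \<open>A translate holds at most one edge for each orientation and difference, so the two
  orientations of an edge give its two translates. The obstacle is that doubling permutes the
  nonzero residues in cycles. A path must break every cycle, and a direct jump to the next one would
  add a translate to each edge of its difference. A jump through a new vertex \<open>w\<close> is
  harmless if its two residue neighbours differ by 3 g with g in \<open>X\<close>: the edges at
  \<open>w\<close> then imitate the missing difference g. A single \<open>w\<close> between fixed
  ends would dictate g, so each jump passes through a freely chosen residue y and two new vertices.
  This y is also needed in its own cycle, where a further new vertex replaces it. The replacement
  loses the differences y/2 and y, but the neighbours y/2 and 2 y of the substitute differ by 3
  (y/2), so it takes y/2 as its own label. Differences such as y stay available as labels for jumps.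
  Since \<open>X\<close> contains no difference together with its negative, every edge between
  residues keeps at least one translate.\<close>

definition steps :: "'a list \<Rightarrow> ('a \<times> 'a) set" where
  "steps xs = set (zip xs (tl xs))"

definition edges_of :: "'a list \<Rightarrow> 'a set set" where
  "edges_of xs = (\<lambda>(x, y). {x, y}) ` steps xs"

definition all_edges :: "'a set \<Rightarrow> 'a set set" where
  "all_edges V = {{u, v} | u v. u \<in> V \<and> v \<in> V \<and> u \<noteq> v}"

text \<open>The vertex type is arbitrary because the construction lives on residues plus new
  vertices; \<open>ssp_le\<close> and \<open>ssp_attained\<close> carry families to and from initial
  segments of the naturals.\<close>

definition separates :: "'a set \<Rightarrow> 'a list set \<Rightarrow> bool" where
  "separates V P \<longleftrightarrow> finite P \<and> (\<forall>p\<in>P. p \<noteq> [] \<and> distinct p \<and> set p \<subseteq> V) \<and>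
     (\<forall>e\<in>all_edges V. \<forall>f\<in>all_edges V. e \<noteq> f \<longrightarrow>
        (\<exists>p\<in>P. e \<in> edges_of p \<and> f \<notin> edges_of p))"

lemma steps_Nil [simp]: "steps [] = {}"
  and steps_single [simp]: "steps [x] = {}"
  and steps_Cons_Cons [simp]: "steps (x # y # zs) = insert (x, y) (steps (y # zs))"
  by (auto simp: steps_def)

lemma steps_append:
  "xs \<noteq> [] \<Longrightarrow> ys \<noteq> [] \<Longrightarrow>
    steps (xs @ ys) = steps xs \<union> steps ys \<union> {(last xs, hd ys)}"
proof (induction xs)
  case (Cons x xs)
  then show ?case
    by (cases xs; cases ys) auto
qed simp

lemma steps_map: "steps (map f xs) = map_prod f f ` steps xs"
proof (induction xs)
  case (Cons x xs)
  then show ?case by (cases xs) auto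
qed simp

lemma edges_of_map: "edges_of (map f xs) = (`) f ` edges_of xs"
  unfolding edges_of_def steps_map image_image by (rule image_cong) auto

lemma steps_nth: "steps xs = {(xs ! i, xs ! Suc i) | i. Suc i < length xs}"
  unfolding steps_def by (auto simp: set_zip nth_tl)

text \<open>The base path is a concatenation of blocks: each of its steps is inside a block or joins
  the end of one block to the head of the next.\<close>

lemma steps_concat_map:
  assumes "\<And>x. x \<in> set xs \<Longrightarrow> f x \<noteq> []"
  shows "steps (concat (map f xs)) =
    (\<Union>x\<in>set xs. steps (f x)) \<union> (\<lambda>(x, y). (last (f x), hd (f y))) ` steps xs"
  using assms
proof (induction xs)
  case (Cons x xs)
  show ?case
  proof (cases xs)
    case (Cons y ys)
    have ne: "f x \<noteq> []" "concat (map f xs) \<noteq> []" "hd (concat (map f xs)) = hd (f y)"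
      using Cons.prems Cons by auto
    show ?thesis using Cons.IH Cons.prems Cons ne by (auto simp: steps_append)
  qed simp
qed simp

lemma steps_in_set: "(x, y) \<in> steps xs \<Longrightarrow> x \<in> set xs \<and> y \<in> set xs"
  by (auto simp: steps_nth)

lemma steps_neq: "distinct xs \<Longrightarrow> (x, y) \<in> steps xs \<Longrightarrow> x \<noteq> y"
  by (auto simp: steps_nth nth_eq_iff_index_eq)

lemma steps_functional: "distinct xs \<Longrightarrow> (x, y) \<in> steps xs \<Longrightarrow> (x, y') \<in> steps xs \<Longrightarrow> y = y'"
  by (auto simp: steps_nth nth_eq_iff_index_eq)

lemma steps_injective: "distinct xs \<Longrightarrow> (x, y) \<in> steps xs \<Longrightarrow> (x', y) \<in> steps xs \<Longrightarrow> x = x'"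
  by (auto simp: steps_nth nth_eq_iff_index_eq)

lemma edges_of_subset_all_edges: "distinct xs \<Longrightarrow> set xs \<subseteq> V \<Longrightarrow> edges_of xs \<subseteq> all_edges V"
  unfolding edges_of_def all_edges_def using steps_neq steps_in_set by fastforce

lemma edges_of_path_edges: "edges_of xs = path_edges xs"
  unfolding edges_of_def path_edges_def steps_nth by auto

lemma all_edges_Kn: "all_edges {..<n} = Kn_edges n"
  unfolding all_edges_def Kn_edges_def by auto

lemma separates_Kn: "finite P \<and> strong_separating_Kn n P \<longleftrightarrow> separates {..<n} P"
  unfolding separates_def strong_separating_Kn_def is_path_Kn_def all_edges_Kn edges_of_path_edges
  by auto

lemma card_edges_of_le: "card (edges_of xs) \<le> length xs - 1"
proof -
  have "card (edges_of xs) \<le> card (steps xs)"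
    unfolding edges_of_def by (rule card_image_le) (simp add: steps_def)
  also have "\<dots> \<le> length (zip xs (tl xs))" unfolding steps_def by (rule card_length)
  finally show ?thesis by simp
qed

lemma all_edges_image:
  assumes "inj_on f V"
  shows "all_edges (f ` V) = (`) f ` all_edges V"
proof -
  have "{f u, f v} \<in> (`) f ` all_edges V" if "u \<in> V" "v \<in> V" "f u \<noteq> f v" for u v
    using that unfolding all_edges_def by (intro image_eqI[of _ _ "{u, v}"]) auto
  moreover have "f ` {u, v} \<in> all_edges (f ` V)" if "u \<in> V" "v \<in> V" "u \<noteq> v" for u v
    using that assms unfolding all_edges_def by (auto simp: inj_on_def)
  ultimately show ?thesis unfolding all_edges_def by fastforce
qed

lemma separates_map:
  assumes sep: "separates V P" and inj: "inj_on f V"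
  shows "separates (f ` V) (map f ` P)"
  unfolding separates_def
proof (intro conjI ballI impI)
  show "finite (map f ` P)" using sep by (simp add: separates_def)
next
  fix p assume "p \<in> map f ` P"
  then obtain q where q: "p = map f q" "q \<in> P" by auto
  have q': "q \<noteq> []" "distinct q" "set q \<subseteq> V" using sep q(2) by (auto simp: separates_def)
  show "p \<noteq> []" "set p \<subseteq> f ` V" using q' q by auto
  show "distinct p" using q' q inj by (simp add: distinct_map inj_on_subset)
next
  fix e e' assume e: "e \<in> all_edges (f ` V)" and e': "e' \<in> all_edges (f ` V)" and ne: "e \<noteq> e'"
  from e e' obtain a a' where a: "e = f ` a" "a \<in> all_edges V" "e' = f ` a'" "a' \<in> all_edges V"
    unfolding all_edges_image[OF inj] by auto
  have "a \<noteq> a'" using ne a by auto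
  then obtain p where p: "p \<in> P" "a \<in> edges_of p" "a' \<notin> edges_of p"
    using sep a unfolding separates_def by metis
  have sub: "edges_of p \<subseteq> all_edges V"
    using sep p(1) by (intro edges_of_subset_all_edges) (auto simp: separates_def)
  have sV: "b \<subseteq> V" if "b \<in> all_edges V" for b using that by (auto simp: all_edges_def)
  have "f ` a' \<notin> edges_of (map f p)"
  proof
    assume "f ` a' \<in> edges_of (map f p)"
    then obtain b where b: "b \<in> edges_of p" "f ` a' = f ` b" unfolding edges_of_map by auto
    hence "a' = b" using inj_on_image_eq_iff[OF inj, of a' b] sV sub a(4) by auto
    thus False using b p by simp
  qed
  moreover have "f ` a \<in> edges_of (map f p)" unfolding edges_of_map using p by auto
  ultimately show "\<exists>p\<in>map f ` P. e \<in> edges_of p \<and> e' \<notin> edges_of p" using p a by auto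
qed

section \<open>Existence and transfer of minimum separating families\<close>

lemma finite_all_edges: "finite V \<Longrightarrow> finite (all_edges V)"
  by (rule finite_subset[of _ "Pow V"]) (auto simp: all_edges_def)

text \<open>Guarantees that the minimum defining \<open>ssp_Kn\<close> is attained and not an
  arbitrary value of \<open>LEAST\<close>.\<close>

lemma separates_single_edges:
  assumes "finite V"
  shows "\<exists>P. separates V P"
proof -
  let ?P = "(\<lambda>(u, v). [u, v]) ` {(u, v). u \<in> V \<and> v \<in> V \<and> u \<noteq> v}"
  have "finite {(u, v). u \<in> V \<and> v \<in> V \<and> u \<noteq> v}"
    by (rule finite_subset[of _ "V \<times> V"]) (use assms in auto)
  hence "separates V ?P"
    unfolding separates_def by (fastforce simp: edges_of_def all_edges_def)
  thus ?thesis by blast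
qed

lemma ssp_le:
  assumes "separates V P" "finite V"
  shows "ssp_Kn (card V) \<le> card P"
proof -
  obtain f where f: "bij_betw f V {..<card V}"
    using assms(2) by (metis finite_same_card_bij finite_lessThan card_lessThan)
  have "separates {..<card V} (map f ` P)"
    using separates_map[OF assms(1), of f] f by (metis bij_betw_def)
  hence "finite (map f ` P) \<and> strong_separating_Kn (card V) (map f ` P)"
    by (simp only: separates_Kn)
  hence "ssp_Kn (card V) \<le> card (map f ` P)"
    unfolding ssp_Kn_def by (intro Least_le) blast
  also have "\<dots> \<le> card P" using assms by (intro card_image_le) (simp add: separates_def)
  finally show ?thesis .
qed

lemma ssp_attained:
  assumes "finite V"
  shows "\<exists>P. separates V P \<and> card P = ssp_Kn (card V)"
proof -
  let ?n = "card V"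
  have "\<exists>k P. finite P \<and> card P = k \<and> strong_separating_Kn ?n P"
    using separates_single_edges[of "{..<?n}"] by (auto simp: separates_Kn[symmetric])
  hence "\<exists>P. finite P \<and> card P = ssp_Kn ?n \<and> strong_separating_Kn ?n P"
    unfolding ssp_Kn_def by (rule LeastI_ex)
  then obtain P where P: "separates {..<?n} P" "card P = ssp_Kn ?n"
    by (auto simp: separates_Kn[symmetric])
  obtain f where f: "bij_betw f {..<?n} V"
    using assms by (metis finite_same_card_bij finite_lessThan card_lessThan)
  have "separates V (map f ` P)"
    using separates_map[OF P(1), of f] f by (metis bij_betw_def)
  moreover have "inj_on (map f) P"
  proof (rule inj_onI)
    fix p q assume "p \<in> P" "q \<in> P" "map f p = map f q"
    moreover have "set p \<union> set q \<subseteq> {..<?n}" using P(1) calculation by (auto simp: separates_def)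
    ultimately show "p = q" using f by (metis bij_betw_def inj_on_subset map_inj_on)
  qed
  ultimately show ?thesis using P(2) card_image by metis
qed

section \<open>Lower bound\<close>

lemma card_all_edges: "finite V \<Longrightarrow> card (all_edges V) = card V choose 2"
proof -
  assume "finite V"
  have "all_edges V = {e. e \<subseteq> V \<and> card e = 2}"
    unfolding all_edges_def card_2_iff by auto
  thus ?thesis using n_subsets[OF \<open>finite V\<close>, of 2] by simp
qed

text \<open>Edges lying on a single path of the family lie on pairwise different paths, so all but
  \<open>card P\<close> edges are covered at least twice.\<close>

lemma card_separating_family_ge:
  assumes sep: "separates V P" and V: "finite V" "card V \<ge> 3"
  shows "card P \<ge> card V - 1"
proof -
  let ?E = "all_edges V" and ?n = "card V"
  define D where "D e = {p\<in>P. e \<in> edges_of p}" for e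
  define A where "A = {e\<in>?E. card (D e) < 2}"
  have fP: "finite P" using sep by (simp add: separates_def)
  have fD: "finite (D e)" for e using fP by (simp add: D_def)
  have fE: "finite ?E" using V by (simp add: finite_all_edges)
  have fA: "finite A" using fE by (simp add: A_def)
  have cE: "card ?E = ?n * (?n - 1) div 2" using V by (simp add: card_all_edges choose_two)
  have "3 * 2 \<le> ?n * (?n - 1)" using V by (intro mult_le_mono) auto
  hence E3: "card ?E \<ge> 3" unfolding cE by linarith
  have D_pos: "card (D e) \<ge> 1" if e: "e \<in> ?E" for e
  proof -
    \<comment> \<open>Separating \<open>e\<close> from any second edge already puts \<open>e\<close>
      on a path; three vertices provide that second edge.\<close>
    have "\<not> ?E \<subseteq> {e}" using E3 card_mono[of "{e}" ?E] by auto
    then obtain f where "f \<in> ?E" "f \<noteq> e" by auto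
    then obtain p where "p \<in> D e" using e sep unfolding separates_def D_def by (metis (mono_tags, lifting) mem_Collect_eq)
    hence "card (D e) > 0" using fD card_gt_0_iff by blast
    thus ?thesis by simp
  qed
  have D1: "\<exists>p. D e = {p}" if "e \<in> A" for e
    proof -
    have "card (D e) = 1" using D_pos[of e] that unfolding A_def by simp
    thus ?thesis by (metis card_1_singletonE)
  qed
  \<comment> \<open>If two edges had the same single path, no path could contain one and miss the
    other.\<close>
  have "inj_on (\<lambda>e. the_elem (D e)) A"
  proof (rule inj_onI, rule ccontr)
    fix e f assume ef: "e \<in> A" "f \<in> A" "the_elem (D e) = the_elem (D f)" "e \<noteq> f"
    then obtain p where "D e = {p}" "D f = {p}" using D1 by (metis the_elem_eq)
    moreover obtain q where "q \<in> D e" "q \<notin> D f"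
      using sep ef unfolding separates_def D_def A_def by (metis (mono_tags, lifting) mem_Collect_eq)
    ultimately show False by auto
  qed
  moreover have "(\<lambda>e. the_elem (D e)) ` A \<subseteq> P"
    using D1 D_def by fastforce
  ultimately have cA: "card A \<le> card P" using fP card_inj_on_le by blast
  have "2 * card ?E = (\<Sum>e\<in>?E. 2)" by simp
  also have "\<dots> \<le> (\<Sum>e\<in>?E. card (D e) + (if e \<in> A then 1 else 0))"
    using D_pos by (intro sum_mono) (auto simp: A_def not_less)
  also have "\<dots> = (\<Sum>e\<in>?E. card (D e)) + card A"
    using fE by (simp add: sum.distrib sum.If_cases A_def Int_def conj_commute)
  also have "(\<Sum>e\<in>?E. card (D e)) = (\<Sum>p\<in>P. card {e\<in>?E. e \<in> edges_of p})"
    unfolding D_def card_eq_sum by (rule sum.swap_restrict[OF fE fP])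
  also have "\<dots> \<le> (\<Sum>p\<in>P. ?n - 1)"
  proof (rule sum_mono)
    fix p assume p: "p \<in> P"
    have "card {e\<in>?E. e \<in> edges_of p} \<le> card (edges_of p)"
      by (rule card_mono) (auto simp: edges_of_def steps_def)
    also have "\<dots> \<le> length p - 1" by (rule card_edges_of_le)
    also have "length p \<le> ?n" using sep p V
      unfolding separates_def by (metis card_mono distinct_card)
    finally show "card {e\<in>?E. e \<in> edges_of p} \<le> ?n - 1" by simp
  qed
  \<comment> \<open>With n vertices this reads n (n - 1) <= card P * (n - 1) + card P = card P * n;
    cancelling n leaves the claim.\<close>
  finally have "2 * card ?E \<le> card P * (?n - 1) + card P" using cA by simp
  moreover have "even (?n * (?n - 1))" by (cases ?n) auto
  hence "2 * card ?E = ?n * (?n - 1)" unfolding cE by (rule dvd_mult_div_cancel)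
  moreover have "card P * ?n = card P * (?n - 1) + card P"
    using V by (simp add: diff_mult_distrib2)
  ultimately have "(?n - 1) * ?n \<le> card P * ?n" by (metis mult.commute)
  thus ?thesis using V by simp
qed

lemma ssp_ge: "n \<ge> 3 \<Longrightarrow> ssp_Kn n \<ge> n - 1"
  using ssp_attained[of "{..<n}"] card_separating_family_ge[of "{..<n}"]
  by (metis card_lessThan finite_lessThan)

section \<open>Translates of a base path\<close>

text \<open>The base path uses the edge from \<open>x\<close> to \<open>2 x\<close> for every nonzero residue \<open>x\<close> outside \<open>X\<close>,
  and passes through every \<open>w \<in> W\<close> between the residues \<open>\<alpha> w\<close> and \<open>\<beta> w\<close>.
  An edge between residues \<open>a\<close>, \<open>b\<close> with \<open>\<plusminus>(a - b) \<notin> X\<close> then lies on exactly the translates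
  by \<open>2 a - b\<close> and \<open>2 b - a\<close>, whose difference is \<open>3 (a - b)\<close>. The condition on \<open>\<beta> w - \<alpha> w\<close>
  gives the edges at \<open>W\<close> pairs with the remaining differences.\<close>

locale base_path =
  fixes N :: int and X :: "int set" and W :: "'w set" and \<alpha> \<beta> g :: "'w \<Rightarrow> int"
    and B :: "(int + 'w) list"
  assumes N_gt: "N > 1" and coprime_2: "coprime N 2" and coprime_3: "coprime N 3"
    and X_sub: "X \<subseteq> {0<..<N}" and X_neg: "\<And>x. x \<in> X \<Longrightarrow> N - x \<notin> X"
    and finite_W: "finite W" and g_inj: "inj_on g W" and g_X: "g ` W \<subseteq> X"
    and beta: "\<And>w. w \<in> W \<Longrightarrow> [\<beta> w = \<alpha> w + 3 * g w] (mod N)"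
    and B_ne: "B \<noteq> []" and B_distinct: "distinct B" and B_set: "set B \<subseteq> Inl ` {0..<N} \<union> Inr ` W"
    and B_edges: "edges_of B = (\<lambda>x. {Inl x, Inl (2 * x mod N)}) ` ({0<..<N} - X) \<union>
      (\<lambda>w. {Inl (\<alpha> w), Inr w}) ` W \<union> (\<lambda>w. {Inl (\<beta> w), Inr w}) ` W"
begin

abbreviation "Z \<equiv> {0..<N}"

definition shift :: "int \<Rightarrow> int + 'w \<Rightarrow> int + 'w" where
  "shift i = map_sum (\<lambda>x. (x + i) mod N) id"

definition translate :: "int \<Rightarrow> (int + 'w) list" where
  "translate i = map (shift i) B"

lemma shift_simps [simp]: "shift i (Inl x) = Inl ((x + i) mod N)" "shift i (Inr w) = Inr w"
  by (auto simp: shift_def)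

section \<open>Which translates contain a given edge\<close>

lemma residue_eq_iff: "a \<in> Z \<Longrightarrow> b mod N = a \<longleftrightarrow> N dvd a - b"
  by (metis atLeastLessThan_iff dvd_diff_commute mod_eq_dvd_iff mod_pos_pos_trivial)

lemma residues_eq: "a \<in> Z \<Longrightarrow> b \<in> Z \<Longrightarrow> N dvd a - b \<Longrightarrow> a = b"
  by (metis residue_eq_iff atLeastLessThan_iff mod_pos_pos_trivial)

lemma edges_translate:
  "edges_of (translate i) = (\<lambda>x. {Inl ((x + i) mod N), Inl ((2 * x + i) mod N)}) ` ({0<..<N} - X) \<union>
    (\<lambda>w. {Inl ((\<alpha> w + i) mod N), Inr w}) ` W \<union> (\<lambda>w. {Inl ((\<beta> w + i) mod N), Inr w}) ` W"
  unfolding translate_def edges_of_map B_edges image_Un image_image by (simp add: mod_simps)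

lemma distinct_translate: "distinct (translate i)"
proof -
  have "inj_on (shift i) (Inl ` Z \<union> Inr ` W)"
  proof (rule inj_onI)
    fix u v assume uv: "u \<in> Inl ` Z \<union> Inr ` W" "v \<in> Inl ` Z \<union> Inr ` W" "shift i u = shift i v"
    have eq: "x = y" if "x \<in> Z" "y \<in> Z" "(x + i) mod N = (y + i) mod N" for x y
      using that residues_eq[of x y] by (simp add: mod_eq_dvd_iff)
    show "u = v" using uv by (cases u; cases v) (auto dest: eq)
  qed
  thus ?thesis unfolding translate_def using B_distinct B_set
    by (simp add: distinct_map inj_on_subset)
qed

lemma set_translate: "set (translate i) \<subseteq> Inl ` Z \<union> Inr ` W"
proof
  fix u assume "u \<in> set (translate i)"
  then obtain v where "v \<in> set B" "u = shift i v" by (auto simp: translate_def)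
  thus "u \<in> Inl ` Z \<union> Inr ` W" using B_set N_gt by (cases v) auto
qed

text \<open>In the translate by i, the edge of difference x runs from x + i to 2 x + i. Reading it
  from a to b forces x = b - a and i = a - x = 2 a - b, so each orientation with difference outside
  \<open>X\<close> accounts for exactly one residue class of i.\<close>

lemma residue_edge_iff:
  assumes "a \<in> Z" "b \<in> Z" "a \<noteq> b"
  shows "{Inl a, Inl b} \<in> edges_of (translate i) \<longleftrightarrow>
    ((b - a) mod N \<notin> X \<and> N dvd i - (2 * a - b)) \<or> ((a - b) mod N \<notin> X \<and> N dvd i - (2 * b - a))"
    (is "?L \<longleftrightarrow> ?R a b \<or> ?R b a")
proof
  have *: "?R c d" if "x \<in> {0<..<N} - X" "c = (x + i) mod N" "d = (2 * x + i) mod N" for c d x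
  proof -
    have "(d - c) mod N = (2 * x + i - (x + i)) mod N" unfolding that by (rule mod_diff_eq)
    also have "\<dots> = x" using that(1) by simp
    finally have 1: "(d - c) mod N = x" .
    have "N dvd c - (x + i)" "N dvd d - (2 * x + i)"
      unfolding that by (simp_all add: mod_eq_dvd_iff[symmetric])
    moreover have "i - (2 * c - d) = (d - (2 * x + i)) - 2 * (c - (x + i))" by simp
    ultimately have "N dvd i - (2 * c - d)" by (metis dvd_diff dvd_mult)
    thus ?thesis using 1 that(1) by simp
  qed
  assume ?L
  then obtain x where "x \<in> {0<..<N} - X"
    "{a, b} = {(x + i) mod N, (2 * x + i) mod N}"
    unfolding edges_translate by (auto simp: doubleton_eq_iff)
  with * show "?R a b \<or> ?R b a" by (metis doubleton_eq_iff)
next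
  have *: "{Inl c, Inl d} \<in> edges_of (translate i)" if R: "?R c d" and cd: "c \<in> Z" "d \<in> Z" "c \<noteq> d" for c d
  proof -
    define x where "x = (d - c) mod N"
    have "x \<noteq> 0" using residues_eq[OF cd(2,1)] cd(3) by (auto simp: x_def dvd_eq_mod_eq_0)
    hence x: "x \<in> {0<..<N} - X" using N_gt R
      by (auto simp: x_def) (smt (verit) pos_mod_sign)
    have "(x + i) mod N = (d - c + i) mod N" by (simp add: x_def mod_simps)
    also have "\<dots> = c" using R cd by (subst residue_eq_iff)
        (auto simp: algebra_simps dvd_diff_commute)
    finally have 1: "(x + i) mod N = c" .
    have "N dvd x - (d - c)" unfolding x_def by (simp add: mod_eq_dvd_iff[symmetric])
    moreover have "2 * x + i - (2 * (d - c) + i) = 2 * (x - (d - c))" by simp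
    ultimately have "(2 * x + i) mod N = (2 * (d - c) + i) mod N"
      unfolding mod_eq_dvd_iff by (metis dvd_mult)
    also have "\<dots> = d" using R cd by (subst residue_eq_iff)
        (auto simp: algebra_simps dvd_diff_commute)
    finally have "(2 * x + i) mod N = d" .
    with x 1 show ?thesis unfolding edges_translate by blast
  qed
  assume "?R a b \<or> ?R b a"
  thus ?L using *[of a b] *[of b a] assms by (metis insert_commute)
qed

lemma mixed_edge_iff:
  assumes "a \<in> Z" "w \<in> W"
  shows "{Inl a, Inr w} \<in> edges_of (translate i) \<longleftrightarrow> N dvd i - (a - \<alpha> w) \<or> N dvd i - (a - \<beta> w)"
proof -
  have "{Inl a, Inr w} \<in> edges_of (translate i) \<longleftrightarrow> (\<alpha> w + i) mod N = a \<or> (\<beta> w + i) mod N = a"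
    unfolding edges_translate using assms by (auto simp: doubleton_eq_iff image_iff)
  also have "\<dots> \<longleftrightarrow> N dvd a - (\<alpha> w + i) \<or> N dvd a - (\<beta> w + i)"
    using residue_eq_iff[OF assms(1)] by simp
  also have "\<dots> \<longleftrightarrow> N dvd i - (a - \<alpha> w) \<or> N dvd i - (a - \<beta> w)"
    using dvd_diff_commute[of N a "\<alpha> w + i"] dvd_diff_commute[of N a "\<beta> w + i"]
    by (simp add: algebra_simps)
  finally show ?thesis .
qed

lemma inner_edge_notin: "{Inr w, Inr w'} \<notin> edges_of (translate i)"
  unfolding edges_translate by (auto simp: doubleton_eq_iff)

lemma dvd_3_cancel: "N dvd 3 * z \<Longrightarrow> N dvd z"
  using coprime_3 coprime_dvd_mult_right_iff by blast

text \<open>Edges lying on exactly the two translates by \<open>c\<close> and \<open>c + 3 d\<close>.\<close>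

definition twice :: "(int + 'w) set \<Rightarrow> int \<Rightarrow> int \<Rightarrow> bool" where
  "twice e c d \<longleftrightarrow>
    (\<exists>a b. e = {Inl a, Inl b} \<and> a \<in> Z \<and> b \<in> Z \<and> a \<noteq> b \<and> (b - a) mod N \<notin> X \<and> (a - b) mod N \<notin> X \<and>
       c = 2 * a - b \<and> d = b - a) \<or>
    (\<exists>a w. e = {Inl a, Inr w} \<and> a \<in> Z \<and> w \<in> W \<and> c = a - \<beta> w \<and> d = g w)"

text \<open>Residue edges and edges at \<open>W\<close> take the same form here: 2 b - a = (2 a - b)
  + 3 (b - a) for the former, and the congruence between \<open>\<beta> w\<close> and
  \<open>\<alpha> w\<close> for the latter.\<close>

lemma twice_iff:
  assumes "twice e c d"
  shows "e \<in> edges_of (translate i) \<longleftrightarrow> N dvd i - c \<or> N dvd i - (c + 3 * d)"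
  using assms unfolding twice_def
proof (elim disjE exE conjE)
  fix a b assume *: "e = {Inl a, Inl b}" "a \<in> Z" "b \<in> Z" "a \<noteq> b" "(b - a) mod N \<notin> X"
    "(a - b) mod N \<notin> X" "c = 2 * a - b" "d = b - a"
  have "c + 3 * d = 2 * b - a" using * by simp
  thus ?thesis using * residue_edge_iff[of a b i] by simp
next
  fix a w assume *: "e = {Inl a, Inr w}" "a \<in> Z" "w \<in> W" "c = a - \<beta> w" "d = g w"
  have "N dvd \<beta> w - (\<alpha> w + 3 * g w)" using beta[OF *(3)] by (simp add: cong_iff_dvd_diff)
  moreover have "i - (c + 3 * d) = (i - (a - \<alpha> w)) + (\<beta> w - (\<alpha> w + 3 * g w))" using * by simp
  ultimately have "N dvd i - (c + 3 * d) \<longleftrightarrow> N dvd i - (a - \<alpha> w)"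
    by (metis dvd_add_left_iff)
  thus ?thesis using mixed_edge_iff[of a w i] * by auto
qed

section \<open>Distinct edges have distinct pairs of translates\<close>

lemma X_dvd_eq: "x \<in> X \<Longrightarrow> y \<in> X \<Longrightarrow> N dvd x - y \<Longrightarrow> x = y"
  using X_sub by (intro residues_eq) auto

lemma X_not_neg: "x \<in> X \<Longrightarrow> y \<in> X \<Longrightarrow> \<not> N dvd x + y"
proof
  assume xy: "x \<in> X" "y \<in> X" "N dvd x + y"
  have "N dvd x - (N - y)" using xy(3) by (simp add: algebra_simps)
  moreover have "N - y \<in> Z" "x \<in> Z" using X_sub xy by auto
  ultimately have "x = N - y" by (intro residues_eq)
  thus False using X_neg xy by auto
qed

lemma twice_diff_nonzero:
  assumes "twice e c d"
  shows "\<not> N dvd d"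
  using assms unfolding twice_def
proof (elim disjE exE conjE)
  fix a b assume *: "a \<in> Z" "b \<in> Z" "a \<noteq> b" "d = b - a"
  thus ?thesis using residues_eq[of b a] by auto
next
  fix a w assume "w \<in> W" "d = g w"
  hence "d \<in> X" using g_X by auto
  hence "0 < d" "d < N" using X_sub by auto
  thus ?thesis by (rule zdvd_not_zless)
qed

text \<open>A residue edge is recovered as a = c + d, b = c + 2 d. An edge at \<open>W\<close> has d
  in \<open>X\<close>, a residue edge never does, so the two kinds cannot be confused; injectivity
  of \<open>g\<close> then recovers \<open>w\<close>.\<close>

lemma twice_unique:
  assumes e: "twice e c d" and f: "twice f c' d'" and dvd: "N dvd c - c'" "N dvd d - d'"
  shows "e = f"
proof -
  have no: False if "x \<in> X" "y mod N \<notin> X" "N dvd y - x" for x y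
  proof -
    have "x \<in> Z" using that X_sub by auto
    hence "y mod N = x" using that(3) by (simp add: residue_eq_iff dvd_diff_commute)
    thus False using that by simp
  qed
  show ?thesis using e[unfolded twice_def] f[unfolded twice_def]
  proof (elim disjE exE conjE)
    fix a b a' b' assume *: "e = {Inl a, Inl b}" "f = {Inl a', Inl b'}" "a \<in> Z" "b \<in> Z" "a' \<in> Z" "b' \<in> Z"
      "c = 2 * a - b" "d = b - a" "c' = 2 * a' - b'" "d' = b' - a'"
    have "a - a' = (c - c') + (d - d')" "b - b' = (c - c') + 2 * (d - d')" using * by simp_all
    hence "N dvd a - a'" "N dvd b - b'" using dvd by (metis dvd_add dvd_mult)+
    thus ?thesis using * residues_eq by metis
  next
    fix a b a' w assume *: "(b - a) mod N \<notin> X" "d = b - a" "w \<in> W" "d' = g w"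
    thus ?thesis using no[of "g w" "b - a"] g_X dvd by auto
  next
    fix a b a' w assume *: "(b - a) mod N \<notin> X" "d' = b - a" "w \<in> W" "d = g w"
    thus ?thesis using no[of "g w" "b - a"] g_X dvd by (auto simp: dvd_diff_commute)
  next
    fix a w a' w' assume *: "e = {Inl a, Inr w}" "a \<in> Z" "w \<in> W" "c = a - \<beta> w" "d = g w"
      "f = {Inl a', Inr w'}" "a' \<in> Z" "w' \<in> W" "c' = a' - \<beta> w'" "d' = g w'"
    have "g w = g w'" using * dvd g_X by (intro X_dvd_eq) auto
    hence "w = w'" using * g_inj by (auto dest: inj_onD)
    moreover have "a = a'" using * dvd calculation by (intro residues_eq) auto
    ultimately show ?thesis using * by simp
  qed
qed

text \<open>The same pair of translates can be read from its other end, as c + 3 d with difference -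
  d. For a residue edge this only exchanges its ends. For an edge at \<open>W\<close> it would put -
  g w among the differences in use, which is excluded because \<open>X\<close> contains no negative
  of its elements and because \<open>twice\<close> keeps both orientations of a residue edge outside
  \<open>X\<close>.\<close>

lemma twice_reversed:
  assumes e: "twice e c d" and f: "twice f c' d'" and dvd: "N dvd c - (c' + 3 * d')" "N dvd d + d'"
  shows "e = f"
proof (cases "\<exists>a b. f = {Inl a, Inl b} \<and> a \<in> Z \<and> b \<in> Z \<and> a \<noteq> b \<and> (b - a) mod N \<notin> X \<and> (a - b) mod N \<notin> X \<and>
       c' = 2 * a - b \<and> d' = b - a")
  case True
  then obtain a b where *: "f = {Inl a, Inl b}" "a \<in> Z" "b \<in> Z" "a \<noteq> b" "(b - a) mod N \<notin> X"
    "(a - b) mod N \<notin> X" "c' = 2 * a - b" "d' = b - a" by blast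
  have "f = {Inl b, Inl a}" using * by (simp add: insert_commute)
  hence "twice f (2 * b - a) (a - b)" unfolding twice_def using * by blast
  moreover have "c' + 3 * d' = 2 * b - a" "d + d' = d - (a - b)" using * by simp_all
  ultimately show ?thesis using twice_unique[OF e] dvd by metis
next
  case False
  then obtain a w where w: "f = {Inl a, Inr w}" "w \<in> W" "d' = g w"
    using f unfolding twice_def by blast
  hence gX: "g w \<in> X" using g_X by auto
  from e[unfolded twice_def] show ?thesis
  proof (elim disjE exE conjE)
    fix a b assume *: "(a - b) mod N \<notin> X" "d = b - a"
    have "N dvd g w - (a - b)" using dvd(2) * w by (simp add: algebra_simps)
    moreover have "g w \<in> Z" using gX X_sub by auto
    ultimately have "(a - b) mod N = g w" by (simp add: residue_eq_iff)
    thus ?thesis using * gX by simp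
  next
    fix a' w' assume "w' \<in> W" "d = g w'"
    thus ?thesis using X_not_neg[of "g w'" "g w"] gX g_X dvd w by auto
  qed
qed

lemma twice_separated:
  assumes e: "twice e c d" and f: "twice f c' d'" and ne: "e \<noteq> f"
  shows "\<exists>i. e \<in> edges_of (translate i) \<and> f \<notin> edges_of (translate i)"
proof (rule ccontr)
  assume "\<not> ?thesis"
  hence 1: "f \<in> edges_of (translate c)" "f \<in> edges_of (translate (c + 3 * d))"
    using twice_iff[OF e, of c] twice_iff[OF e, of "c + 3 * d"] by auto
  from 1 have "N dvd c - c' \<or> N dvd c - (c' + 3 * d')"
    "N dvd c + 3 * d - c' \<or> N dvd c + 3 * d - (c' + 3 * d')"
    unfolding twice_iff[OF f] by auto
  \<comment> \<open>The two translates of \<open>e\<close> are different modulo \<open>N\<close>,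
    since 3 is invertible; they cannot both match the same translate of \<open>f\<close>.\<close>
  moreover have False if "N dvd c - z" "N dvd c + 3 * d - z" for z
  proof -
    have "N dvd (c + 3 * d - z) - (c - z)" using that by (metis dvd_diff)
    hence "N dvd 3 * d" by simp
    thus False using dvd_3_cancel twice_diff_nonzero[OF e] by blast
  qed
  moreover have False if "N dvd c - c'" "N dvd c + 3 * d - (c' + 3 * d')"
  proof -
    have "N dvd (c + 3 * d - (c' + 3 * d')) - (c - c')" using that by (metis dvd_diff)
    hence "N dvd 3 * (d - d')" by (simp add: algebra_simps)
    thus False using twice_unique[OF e f that(1)] dvd_3_cancel ne by blast
  qed
  moreover have False if "N dvd c - (c' + 3 * d')" "N dvd c + 3 * d - c'"
  proof -
    have "N dvd (c + 3 * d - c') - (c - (c' + 3 * d'))" using that by (metis dvd_diff)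
    hence "N dvd 3 * (d + d')" by (simp add: algebra_simps)
    thus False using twice_reversed[OF e f that(1)] dvd_3_cancel ne by blast
  qed
  ultimately show False by blast
qed

text \<open>The orientation with difference in \<open>X\<close> is lost, while the opposite
  difference is outside \<open>X\<close>, so one translate remains.\<close>

lemma once_iff:
  assumes "a \<in> Z" "b \<in> Z" "(b - a) mod N \<in> X"
  shows "{Inl a, Inl b} \<in> edges_of (translate i) \<longleftrightarrow> N dvd i - (2 * b - a)"
proof -
  have "a \<noteq> b" using assms X_sub by auto
  moreover have "(a - b) mod N \<notin> X"
  proof
    assume "(a - b) mod N \<in> X"
    moreover have "N dvd (b - a) mod N + (a - b) mod N"
      by (simp add: dvd_eq_mod_eq_0 mod_simps)
    ultimately show False using X_not_neg assms(3) by blast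
  qed
  ultimately show ?thesis using assms residue_edge_iff by simp
qed

lemma twice_once_separated:
  assumes "twice e c d" "a \<in> Z" "b \<in> Z" "(b - a) mod N \<in> X"
  shows "\<exists>i. e \<in> edges_of (translate i) \<and> {Inl a, Inl b} \<notin> edges_of (translate i)"
proof (rule ccontr)
  assume "\<not> ?thesis"
  hence "N dvd c - (2 * b - a)" "N dvd c + 3 * d - (2 * b - a)"
    using twice_iff[OF assms(1), of c] twice_iff[OF assms(1), of "c + 3 * d"] once_iff[OF assms(2-)]
    by auto
  hence "N dvd (c + 3 * d - (2 * b - a)) - (c - (2 * b - a))" by (metis dvd_diff)
  hence "N dvd 3 * d" by simp
  thus False using dvd_3_cancel twice_diff_nonzero[OF assms(1)] by blast
qed

text \<open>Inside one difference class the single translate 2 b - a together with the common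
  difference b - a determines a and b. Translates thus separate such edges within a class, and only
  other classes need the serpentines.\<close>

lemma once_separated:
  assumes "a \<in> Z" "b \<in> Z" "(b - a) mod N \<in> X" "a' \<in> Z" "b' \<in> Z"
    "(b' - a') mod N = (b - a) mod N" "{a, b} \<noteq> {a', b'}"
  shows "\<exists>i. {Inl a, Inl b} \<in> edges_of (translate i) \<and> {Inl a', Inl b'} \<notin> edges_of (translate i)"
proof (rule ccontr)
  assume "\<not> ?thesis"
  hence "N dvd 2 * b - a - (2 * b' - a')"
    using once_iff[of a b "2 * b - a"] once_iff[of a' b' "2 * b - a"] assms by auto
  moreover have "N dvd (b - a) - (b' - a')" using assms(6) by (metis mod_eq_dvd_iff)
  moreover have "b - b' = (2 * b - a - (2 * b' - a')) - ((b - a) - (b' - a'))"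
    "a - a' = (2 * b - a - (2 * b' - a')) - 2 * ((b - a) - (b' - a'))" by simp_all
  ultimately have "N dvd b - b'" "N dvd a - a'" by (metis dvd_diff dvd_mult)+
  thus False using residues_eq assms by metis
qed

lemma translate_mod: "edges_of (translate (i mod N)) = edges_of (translate i)"
  unfolding edges_translate by (simp add: mod_simps)

end

section \<open>Serpentine paths for a single difference\<close>

text \<open>For odd \<open>N\<close> and 0 < x < N these are gcd x N disjoint cycles of length N /
  gcd x N, one on each coset of the subgroup generated by x.\<close>

definition class_edges :: "int \<Rightarrow> int \<Rightarrow> int set set" where
  "class_edges N x = (\<lambda>a. {a, (a + x) mod N}) ` {0..<N}"

text \<open>The serpentine runs through the cosets of the subgroup generated by \<open>x\<close>, which has order \<open>m\<close>,
  omitting one edge per coset; the offset \<open>t\<close> rotates the starting points.\<close>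

definition serpentine :: "int \<Rightarrow> int \<Rightarrow> int \<Rightarrow> int \<Rightarrow> int list" where
  "serpentine N x m t = map (\<lambda>p. (p div m + (p mod m + t) * x) mod N) [0..N - 1]"

locale serpentines =
  fixes N x d m :: int
  assumes N_gt: "N > 1" and x_range: "0 < x" "x < N" and odd_N: "odd N"
    and d_def: "d = gcd x N" and N_eq: "N = d * m"
begin

lemma d_pos: "d > 0" and m_pos: "m > 0"
proof -
  show d: "d > 0" unfolding d_def using N_gt by (simp add: gcd_pos_int)
  show "m > 0" using N_gt N_eq d by (metis zero_less_mult_pos dual_order.strict_trans zero_less_one)
qed

lemma m_dvd:
  assumes "N dvd k * x"
  shows "m dvd k"
proof -
  obtain x' where x': "x = d * x'" using d_def by (metis dvd_def gcd_dvd1)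
  have "gcd x N = d * gcd x' m" unfolding N_eq x' using d_pos by (simp add: gcd_mult_left)
  hence "d * 1 = d * gcd x' m" using d_def by simp
  hence "gcd x' m = 1" using d_pos by (metis mult_cancel_left less_irrefl)
  hence "coprime m x'" by (simp add: coprime_iff_gcd_eq_1 gcd.commute)
  moreover have "d * m dvd d * (k * x')" using assms N_eq x' by (simp add: algebra_simps)
  hence "m dvd k * x'" using d_pos by (simp only: dvd_mult_cancel_left) simp
  ultimately show ?thesis by (simp add: coprime_dvd_mult_left_iff)
qed

text \<open>\<open>m\<close> divides the odd \<open>N\<close> and is not 1 because \<open>N\<close>
  does not divide \<open>x\<close>. The bound makes the offsets 0, 1, 2 distinct modulo
  \<open>m\<close>.\<close>

lemma m_ge_3: "m \<ge> 3"
proof -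
  have "m \<noteq> 1" using d_def N_eq x_range zdvd_imp_le[of N x] by (metis gcd_dvd1 linorder_not_less mult.right_neutral)
  moreover have "odd m" using odd_N N_eq by simp
  hence "m \<noteq> 2" by auto
  ultimately show ?thesis using m_pos by linarith
qed

text \<open>Uniqueness of the coordinates: j modulo \<open>d\<close> names the coset and k modulo
  \<open>m\<close> the position in it. Existence is \<open>residue_coset\<close>.\<close>

lemma coset_eq:
  assumes "N dvd (j + k * x) - (j' + k' * x)" "0 \<le> j" "j < d" "0 \<le> j'" "j' < d"
  shows "j = j'" "m dvd k - k'"
proof -
  have "d dvd N" "d dvd x" using d_def by simp_all
  hence "d dvd ((j + k * x) - (j' + k' * x)) - (k - k') * x"
    using assms(1) by (metis dvd_diff dvd_mult dvd_trans)
  hence "d dvd j - j'" by (simp add: algebra_simps)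
  hence "j mod d = j' mod d" by (simp add: mod_eq_dvd_iff)
  thus j: "j = j'" using assms by simp
  have "N dvd (k - k') * x" using assms(1) j by (simp add: algebra_simps)
  thus "m dvd k - k'" by (rule m_dvd)
qed

lemma pos_range: "p \<in> {0..<N} \<Longrightarrow> 0 \<le> p div m \<and> p div m < d"
proof -
  assume p: "p \<in> {0..<N}"
  have "p div m * m \<le> p" using m_pos by (simp add: minus_mod_eq_div_mult[symmetric])
  hence "p div m * m < d * m" using p N_eq by simp
  thus ?thesis using m_pos p by (simp add: pos_imp_zdiv_nonneg_iff)
qed

lemma vertices_eq:
  assumes "p \<in> {0..<N}" "q \<in> {0..<N}"
    "(p div m + (p mod m + t) * x) mod N = (q div m + (q mod m + t') * x) mod N"
  shows "p div m = q div m" "m dvd (p mod m + t) - (q mod m + t')"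
  using coset_eq[of "p div m" "p mod m + t" "q div m" "q mod m + t'"] assms pos_range
  by (auto simp: mod_eq_dvd_iff)

lemma distinct_serpentine: "distinct (serpentine N x m t)"
proof -
  have *: "p = q" if "p \<in> {0..<N}" "q \<in> {0..<N}"
    "(p div m + (p mod m + t) * x) mod N = (q div m + (q mod m + t) * x) mod N" for p q
  proof -
    have "m dvd p mod m - q mod m" using vertices_eq(2)[OF that] by simp
    hence "p mod m = q mod m" by (simp add: mod_eq_dvd_iff[symmetric])
    thus "p = q" using vertices_eq(1)[OF that] by (metis div_mult_mod_eq)
  qed
  have "{0..N - 1} = {0..<N}" by auto
  thus ?thesis unfolding serpentine_def distinct_map
    by (metis (no_types, lifting) * distinct_upto set_upto inj_onI)
qed

lemma serpentine_ne: "serpentine N x m t \<noteq> []"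
  unfolding serpentine_def using N_gt by simp

lemma set_serpentine: "set (serpentine N x m t) \<subseteq> {0..<N}"
  unfolding serpentine_def using N_gt by auto

lemma steps_upto: "steps [i..j] = {(p, p + 1) | p. i \<le> p \<and> p < j}"
proof -
  have "steps [i..j] = (\<lambda>k. ([i..j] ! k, [i..j] ! Suc k)) ` {k. Suc k < nat (j - i + 1)}"
    unfolding steps_nth length_upto by blast
  also have "\<dots> = (\<lambda>k. (i + int k, i + int k + 1)) ` {k. Suc k < nat (j - i + 1)}"
    by (rule image_cong) (auto simp: nth_upto)
  also have "\<dots> = {(p, p + 1) | p. i \<le> p \<and> p < j}"
  proof (rule subset_antisym; rule subsetI)
    fix q assume "q \<in> {(p, p + 1) | p. i \<le> p \<and> p < j}"
    then obtain p where "q = (p, p + 1)" "i \<le> p" "p < j" by auto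
    thus "q \<in> (\<lambda>k. (i + int k, i + int k + 1)) ` {k. Suc k < nat (j - i + 1)}"
      by (intro image_eqI[of _ _ "nat (p - i)"]) auto
  qed auto
  finally show ?thesis .
qed

lemma serpentine_edges:
  "edges_of (serpentine N x m t) = {{(p div m + (p mod m + t) * x) mod N,
     ((p + 1) div m + ((p + 1) mod m + t) * x) mod N} | p. 0 \<le> p \<and> p < N - 1}"
  unfolding serpentine_def edges_of_def steps_map steps_upto setcompr_eq_image image_image by simp

lemma residue_coset:
  obtains j k where "0 \<le> j" "j < d" "N dvd a - (j + k * x)"
proof -
  obtain u v where uv: "u * x + v * N = d" using bezout_int d_def by metis
  define j where "j = a mod d"
  obtain c where c: "a - j = d * c" unfolding j_def by (metis dvd_def dvd_minus_mod)
  have "a - (j + (u * c) * x) = d * c - u * c * x" using c by simp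
  also have "\<dots> = N * (v * c)" unfolding uv[symmetric] by (simp add: algebra_simps)
  finally have "N dvd a - (j + (u * c) * x)" by simp
  moreover have "0 \<le> j" "j < d" unfolding j_def using d_pos by auto
  ultimately show ?thesis using that by blast
qed

lemma div_mod_rect: "0 \<le> r \<Longrightarrow> r < m \<Longrightarrow> (j * m + r) div m = j \<and> (j * m + r) mod m = r"
  by (simp add: div_pos_pos_trivial mod_pos_pos_trivial)

text \<open>In each coset the walk starts at position t and stops one edge short of closing the
  cycle, so only the edge from position t - 1 to t is absent.\<close>

lemma class_edge_in_serpentine:
  assumes j: "0 \<le> j" "j < d" and k: "\<not> m dvd k + 1 - t"
  shows "{(j + k * x) mod N, (j + (k + 1) * x) mod N} \<in> edges_of (serpentine N x m t)"
proof -
  define r where "r = (k - t) mod m"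
  have r: "0 \<le> r" "r < m" using m_pos by (auto simp: r_def)
  have "r \<noteq> m - 1"
  proof
    assume "r = m - 1"
    moreover have "(m - 1) mod m = m - 1" using m_pos by (intro mod_pos_pos_trivial) auto
    ultimately have "(k - t) mod m = (m - 1) mod m" by (simp only: r_def)
    hence "m dvd (k - t) - (m - 1)" by (simp only: mod_eq_dvd_iff)
    hence "m dvd (k - t) - (m - 1) + m" by (metis dvd_add dvd_refl)
    thus False using k by (simp add: algebra_simps)
  qed
  hence r1: "r + 1 < m" using r by simp
  obtain c where c: "k - t = r + m * c" unfolding r_def by (metis add.commute mult_div_mod_eq)
  define p where "p = j * m + r"
  have p: "p div m = j" "p mod m = r" "(p + 1) div m = j" "(p + 1) mod m = r + 1"
    using r r1 div_mod_rect[of r j] div_mod_rect[of "r + 1" j] unfolding p_def by (simp_all add: add.assoc)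
  have "j * m + m \<le> d * m" using j m_pos by (metis (no_types) distrib_right mult_1 mult_right_mono zless_imp_add1_zle order_less_imp_le)
  hence "p < N - 1" using r1 N_eq by (simp add: p_def)
  moreover have "0 \<le> p" using j r m_pos by (simp add: p_def)
  moreover obtain c' where c': "m * x = N * c'"
    using N_eq d_def by (metis dvd_def gcd_dvd1 mult.assoc mult.commute)
  have "k = r + t + m * c" using c by simp
  hence kx: "k * x = (r + t) * x + N * (c' * c)" using c' by (simp add: algebra_simps)
  have "j + k * x = (j + (r + t) * x) + N * (c' * c)" using kx by simp
  hence "(j + k * x) mod N = (p div m + (p mod m + t) * x) mod N" unfolding p by (metis mod_mult_self2)
  moreover have "j + (k + 1) * x = (j + (r + 1 + t) * x) + N * (c' * c)"
    using kx by (simp add: algebra_simps)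
  hence "(j + (k + 1) * x) mod N = ((p + 1) div m + ((p + 1) mod m + t) * x) mod N"
    unfolding p by (metis mod_mult_self2)
  ultimately have "\<exists>p. {(j + k * x) mod N, (j + (k + 1) * x) mod N} =
    {(p div m + (p mod m + t) * x) mod N, ((p + 1) div m + ((p + 1) mod m + t) * x) mod N} \<and>
    0 \<le> p \<and> p < N - 1" by (intro exI[of _ p]) simp
  thus ?thesis unfolding serpentine_edges mem_Collect_eq .
qed

text \<open>An edge outside the class can only join the end of one coset to the start of the next;
  the end is at position m - 1 + t, which is t - 1 modulo \<open>m\<close>.\<close>

lemma link_edge:
  assumes f: "f \<in> edges_of (serpentine N x m t)" "f \<notin> class_edges N x"
  obtains j where "0 \<le> j" "j + 1 < d" "f = {(j + (t - 1) * x) mod N, (j + 1 + t * x) mod N}"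
proof -
  obtain p where p: "0 \<le> p" "p < N - 1" and fp: "f = {(p div m + (p mod m + t) * x) mod N,
     ((p + 1) div m + ((p + 1) mod m + t) * x) mod N}" using f(1) unfolding serpentine_edges by blast
  define j r where "j = p div m" "r = p mod m"
  have pj: "p = j * m + r" by (simp add: j_r_def)
  have r: "0 \<le> r" "r < m" using m_pos by (auto simp: j_r_def)
  have "r + 1 = m"
  proof (rule ccontr)
    assume "r + 1 \<noteq> m"
    hence r1: "r + 1 < m" using r by simp
    hence p1: "(p + 1) div m = j" "(p + 1) mod m = r + 1"
      using r r1 div_mod_rect[of "r + 1" j] unfolding pj by (simp_all add: add.assoc)
    have "(j + (r + t) * x + x) mod N = (j + (r + 1 + t) * x) mod N" by (simp add: algebra_simps)
    hence "f = {(j + (r + t) * x) mod N, ((j + (r + t) * x) mod N + x) mod N}"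
      unfolding fp p1 j_r_def[symmetric] by (simp add: mod_simps)
    hence "f \<in> class_edges N x" unfolding class_edges_def using N_gt by auto
    thus False using f(2) by simp
  qed
  hence p1: "p + 1 = (j + 1) * m" and r': "r = m - 1" using pj by (simp_all add: algebra_simps)
  have p2: "(p + 1) div m = j + 1" "(p + 1) mod m = 0" unfolding p1 using m_pos by auto
  have "(j + 1) * m < d * m" using p p1 N_eq by simp
  hence "j + 1 < d" using m_pos by simp
  moreover have "0 \<le> j" using p m_pos by (simp add: j_r_def pos_imp_zdiv_nonneg_iff)
  moreover obtain c' where c': "m * x = N * c'"
    using N_eq d_def by (metis dvd_def gcd_dvd1 mult.assoc mult.commute)
  have "j + (r + t) * x = j + (t - 1) * x + N * c'" unfolding r' c'[symmetric] by (simp add: algebra_simps)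
  hence "f = {(j + (t - 1) * x) mod N, (j + 1 + t * x) mod N}"
    unfolding fp p2 j_r_def[symmetric] by (simp only: mod_mult_self2 add_0)
  ultimately show ?thesis using that by blast
qed

text \<open>A link determines its offset modulo \<open>m\<close>. Reading one of the two links
  backwards would need j = j' + 1 and j + 1 = j' at once.\<close>

lemma link_edge_unique:
  assumes "f \<in> edges_of (serpentine N x m t)" "f \<in> edges_of (serpentine N x m t')"
    "f \<notin> class_edges N x"
  shows "m dvd t - t'"
proof -
  obtain j where j: "0 \<le> j" "j + 1 < d" "f = {(j + (t - 1) * x) mod N, (j + 1 + t * x) mod N}"
    using link_edge[OF assms(1,3)] by blast
  obtain j' where j': "0 \<le> j'" "j' + 1 < d" "f = {(j' + (t' - 1) * x) mod N, (j' + 1 + t' * x) mod N}"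
    using link_edge[OF assms(2,3)] by blast
  have "(j + (t - 1) * x) mod N = (j' + (t' - 1) * x) mod N \<or>
    (j + (t - 1) * x) mod N = (j' + 1 + t' * x) mod N \<and>
    (j + 1 + t * x) mod N = (j' + (t' - 1) * x) mod N"
    using j(3) j'(3) by (metis doubleton_eq_iff)
  thus ?thesis
  proof (elim disjE conjE)
    assume "(j + (t - 1) * x) mod N = (j' + (t' - 1) * x) mod N"
    hence "m dvd (t - 1) - (t' - 1)" using j j' by (intro coset_eq(2)[of j _ j']) (auto simp: mod_eq_dvd_iff)
    thus ?thesis by simp
  next
    assume "(j + (t - 1) * x) mod N = (j' + 1 + t' * x) mod N"
      "(j + 1 + t * x) mod N = (j' + (t' - 1) * x) mod N"
    hence "j = j' + 1" "j + 1 = j'"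
      using coset_eq(1)[of j "t - 1" "j' + 1" t'] coset_eq(1)[of "j + 1" t j' "t' - 1"] j j'
      by (auto simp: mod_eq_dvd_iff)
    thus ?thesis by simp
  qed
qed

text \<open>Of the three offsets at most one omits \<open>e\<close>, and at most one uses
  \<open>f\<close> as a link, so some offset is left. This is why three paths per difference
  suffice.\<close>

lemma serpentine_separates:
  assumes e: "e \<in> class_edges N x" and f: "f \<notin> class_edges N x"
  shows "\<exists>t\<in>{0, 1, 2}. e \<in> edges_of (serpentine N x m t) \<and> f \<notin> edges_of (serpentine N x m t)"
proof -
  obtain a where a: "a \<in> {0..<N}" "e = {a, (a + x) mod N}" using e unfolding class_edges_def by auto
  obtain j k where jk: "0 \<le> j" "j < d" "N dvd a - (j + k * x)" using residue_coset by blast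
  have 1: "(j + k * x) mod N = a" using jk(3) a(1) by (metis atLeastLessThan_iff mod_eq_dvd_iff mod_pos_pos_trivial)
  have "N dvd (a + x) - (j + (k + 1) * x)" using jk(3) by (simp add: algebra_simps)
  hence 2: "(j + (k + 1) * x) mod N = (a + x) mod N" by (simp add: mod_eq_dvd_iff[symmetric])
  have e_in: "e \<in> edges_of (serpentine N x m t)" if "\<not> m dvd k + 1 - t" for t
    using class_edge_in_serpentine[OF jk(1,2) that] unfolding 1 2 a(2) .
  have ndvd: "\<not> m dvd t - t'" if "t \<noteq> t'" "t \<in> {0,1,2}" "t' \<in> {0,1,2}" for t t'
  proof
    assume "m dvd t - t'"
    hence "\<bar>m\<bar> \<le> \<bar>t - t'\<bar>" using that by (intro dvd_imp_le_int) auto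
    thus False using that m_ge_3 by auto
  qed
  have e_miss: "t = t'" if "m dvd k + 1 - t" "m dvd k + 1 - t'" "t \<in> {0,1,2}" "t' \<in> {0,1,2}" for t t'
  proof -
    have "m dvd (k + 1 - t') - (k + 1 - t)" using that by (metis dvd_diff)
    thus ?thesis using ndvd[of t t'] that by auto
  qed
  have f_in: "t = t'" if "f \<in> edges_of (serpentine N x m t)" "f \<in> edges_of (serpentine N x m t')"
    "t \<in> {0,1,2}" "t' \<in> {0,1,2}" for t t'
    using link_edge_unique[OF that(1,2) f] ndvd[of t t'] that by auto
  have neq: "(0::int) \<noteq> 1" "(0::int) \<noteq> 2" "(1::int) \<noteq> 2" by auto
  have mem: "(0::int) \<in> {0,1,2}" "(1::int) \<in> {0,1,2}" "(2::int) \<in> {0,1,2}" by auto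
  show ?thesis using e_in e_miss f_in neq mem by metis
qed

end

lemma serpentine_family:
  fixes N x :: int
  assumes "N > 1" "0 < x" "x < N" "odd N"
  obtains Q where "finite Q" "card Q \<le> 3"
    "\<And>q. q \<in> Q \<Longrightarrow> q \<noteq> [] \<and> distinct q \<and> set q \<subseteq> {0..<N}"
    "\<And>e f. e \<in> class_edges N x \<Longrightarrow> f \<notin> class_edges N x \<Longrightarrow>
       \<exists>q\<in>Q. e \<in> edges_of q \<and> f \<notin> edges_of q"
proof -
  interpret serpentines N x "gcd x N" "N div gcd x N"
    by unfold_locales (use assms in auto)
  let ?m = "N div gcd x N"
  let ?Q = "serpentine N x ?m ` {0, 1, 2}"
  have "card ?Q \<le> card {0::int, 1, 2}" by (rule card_image_le) simp
  moreover have "q \<noteq> [] \<and> distinct q \<and> set q \<subseteq> {0..<N}" if "q \<in> ?Q" for q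
  proof -
    from that obtain t where "q = serpentine N x ?m t" by auto
    thus ?thesis using serpentine_ne distinct_serpentine set_serpentine by simp
  qed
  moreover have "\<exists>q\<in>?Q. e \<in> edges_of q \<and> f \<notin> edges_of q"
    if "e \<in> class_edges N x" "f \<notin> class_edges N x" for e f
    using serpentine_separates[OF that] by blast
  moreover have "card {0::int, 1, 2} = 3" by simp
  ultimately show ?thesis by (intro that[of ?Q]) simp_all
qed

section \<open>The upper bound from a base path\<close>

context base_path
begin

abbreviation "vertices \<equiv> Inl ` Z \<union> Inr ` W"

lemma vertex_edge_cases:
  assumes "e \<in> all_edges vertices"
  obtains (inner) w w' where "e = {Inr w, Inr w'}" "w \<in> W" "w' \<in> W" "w \<noteq> w'"
  | (two) c d where "twice e c d"
  | (one) a b where "e = {Inl a, Inl b}" "a \<in> Z" "b \<in> Z" "(b - a) mod N \<in> X"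
proof -
  have mixed: "\<exists>c d. twice {Inl a, Inr w} c d" if "a \<in> Z" "w \<in> W" for a w
    using that unfolding twice_def by blast
  obtain u v where uv: "e = {u, v}" "u \<in> vertices" "v \<in> vertices" "u \<noteq> v"
    using assms unfolding all_edges_def by blast
  show ?thesis
  proof (cases u)
    case u: (Inl a)
    hence a: "a \<in> Z" using uv by auto
    show ?thesis
    proof (cases v)
      case v: (Inl b)
      hence b: "b \<in> Z" "a \<noteq> b" using uv u by auto
      have e: "e = {Inl a, Inl b}" "e = {Inl b, Inl a}" using uv u v by auto
      show ?thesis
      proof (cases "(b - a) mod N \<in> X \<or> (a - b) mod N \<in> X")
        case True
        thus ?thesis using one[of a b] one[of b a] a b e by blast
      next
        case False
        hence "twice e (2 * a - b) (b - a)" unfolding twice_def using a b e by blast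
        thus ?thesis by (rule two)
      qed
    next
      case (Inr w)
      hence "w \<in> W" "e = {Inl a, Inr w}" using uv u by auto
      thus ?thesis using mixed a two by blast
    qed
  next
    case u: (Inr w)
    hence w: "w \<in> W" using uv by auto
    show ?thesis
    proof (cases v)
      case (Inl a)
      hence "a \<in> Z" "e = {Inl a, Inr w}" using uv u by auto
      thus ?thesis using mixed w two by blast
    next
      case (Inr w')
      hence "w' \<in> W" "w \<noteq> w'" "e = {Inr w, Inr w'}" using uv u by auto
      thus ?thesis using inner w by blast
    qed
  qed
qed

lemma translate_rep: "\<exists>p\<in>translate ` Z. edges_of p = edges_of (translate i)"
  using translate_mod[of i] N_gt by (intro bexI[of _ "translate (i mod N)"]) auto

lemma class_edges_iff:
  "a \<in> Z \<Longrightarrow> b \<in> Z \<Longrightarrow> (b - a) mod N = x \<Longrightarrow> {a, b} \<in> class_edges N x"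
proof -
  assume ab: "a \<in> Z" "b \<in> Z" "(b - a) mod N = x"
  have "(a + x) mod N = b" unfolding ab(3)[symmetric] using ab(2) by (simp add: mod_simps)
  thus ?thesis unfolding class_edges_def using ab by auto
qed

text \<open>The family consists of the translates, three serpentines for each x in \<open>X\<close>,
  and a minimum family on \<open>W\<close>. Translates separate the edges of type
  \<open>twice\<close> from everything; an edge with difference in \<open>X\<close> is separated by
  translates inside its class and by serpentines from the rest; edges inside \<open>W\<close> use
  the last part.\<close>

theorem ssp_le_base_path:
  assumes W3: "card W \<ge> 3"
  shows "ssp_Kn (nat N + card W) \<le> nat N + 3 * card X + ssp_Kn (card W)"
proof -
  have odd_N: "odd N" using coprime_2 by (metis coprime_right_2_iff_odd)
  have finX: "finite X" using X_sub by (rule finite_subset) simp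
  define G where "G x Q \<longleftrightarrow> finite Q \<and> card Q \<le> 3 \<and>
    (\<forall>q\<in>Q. q \<noteq> [] \<and> distinct q \<and> set q \<subseteq> Z) \<and>
    (\<forall>e f. e \<in> class_edges N x \<longrightarrow> f \<notin> class_edges N x \<longrightarrow>
      (\<exists>q\<in>Q. e \<in> edges_of q \<and> f \<notin> edges_of q))" for x Q
  have "\<forall>x\<in>X. \<exists>Q. G x Q"
  proof
    fix x assume "x \<in> X"
    hence x: "0 < x" "x < N" using X_sub by auto
    show "\<exists>Q. G x Q" using serpentine_family[OF N_gt x odd_N] unfolding G_def by metis
  qed
  then obtain Q where "\<forall>x\<in>X. G x (Q x)" using bchoice by blast
  hence Q: "\<And>x. x \<in> X \<Longrightarrow> finite (Q x)" "\<And>x. x \<in> X \<Longrightarrow> card (Q x) \<le> 3"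
    "\<And>x q. x \<in> X \<Longrightarrow> q \<in> Q x \<Longrightarrow> q \<noteq> [] \<and> distinct q \<and> set q \<subseteq> Z"
    "\<And>x e f. x \<in> X \<Longrightarrow> e \<in> class_edges N x \<Longrightarrow> f \<notin> class_edges N x \<Longrightarrow>
      \<exists>q\<in>Q x. e \<in> edges_of q \<and> f \<notin> edges_of q"
    unfolding G_def by simp_all
  obtain R where R: "separates W R" "card R = ssp_Kn (card W)"
    using ssp_attained[OF finite_W] by blast
  define FT where "FT = translate ` Z"
  define FS :: "(int + 'w) list set" where "FS = (\<Union>x\<in>X. map Inl ` Q x)"
  define FW :: "(int + 'w) list set" where "FW = map Inr ` R"
  define F where "F = FT \<union> FS \<union> FW"
  have finR: "finite R" using R(1) by (simp add: separates_def)
  have fin: "finite FT" "finite FS" "finite FW"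
    using finX Q(1) finR by (simp_all add: FT_def FS_def FW_def)
  have once: "\<exists>p\<in>F. e \<in> edges_of p \<and> f \<notin> edges_of p"
    if e: "e = {Inl a, Inl b}" "a \<in> Z" "b \<in> Z" "(b - a) mod N \<in> X" and ne: "e \<noteq> f" for e f a b
  proof -
    define x where "x = (b - a) mod N"
    have xX: "x \<in> X" using e by (simp add: x_def)
    have ab: "{a, b} \<in> class_edges N x" using e by (simp add: class_edges_iff x_def)
    show ?thesis
    proof (cases "\<exists>h. f = Inl ` h \<and> h \<in> class_edges N x")
      case True
      then obtain a' where a': "a' \<in> Z" "f = Inl ` {a', (a' + x) mod N}" unfolding class_edges_def by auto
      define b' where "b' = (a' + x) mod N"
      have "x \<in> Z" using xX X_sub by auto
      hence "(b' - a') mod N = x" unfolding b'_def by (simp add: mod_simps)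
      moreover have "b' \<in> Z" unfolding b'_def using N_gt by simp
      moreover have f: "f = {Inl a', Inl b'}" using a' by (simp add: b'_def)
      moreover have "{a, b} \<noteq> {a', b'}"
      proof
        assume "{a, b} = {a', b'}"
        hence "(Inl ` {a, b} :: (int + 'w) set) = Inl ` {a', b'}" by simp
        thus False using ne e(1) f by simp
      qed
      ultimately obtain i where "e \<in> edges_of (translate i)" "f \<notin> edges_of (translate i)"
        using once_separated[of a b a' b'] e a'(1) x_def by auto
      thus ?thesis using translate_rep[of i] unfolding F_def FT_def by blast
    next
      case False
      define h where "h = {y. Inl y \<in> f}"
      \<comment> \<open>\<open>f\<close> may touch \<open>W\<close> and then is no set of residues;
        the empty set serves as a dummy outside every class, so that \<open>Q(4)\<close> still
        applies.\<close>
      have "(if f = Inl ` h then h else {}) \<notin> class_edges N x"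
        using False by (auto simp: class_edges_def)
      then obtain q where q: "q \<in> Q x" "{a, b} \<in> edges_of q"
        "(if f = Inl ` h then h else {}) \<notin> edges_of q"
        using Q(4)[OF xX ab] by blast
      have "(Inl ` {a, b} :: (int + 'w) set) \<in> edges_of (map Inl q)" unfolding edges_of_map using q(2) by (rule imageI)
      moreover have "f \<notin> edges_of (map Inl q)"
      proof
        assume "f \<in> edges_of (map Inl q)"
        then obtain h' where h': "f = Inl ` h'" "h' \<in> edges_of q" unfolding edges_of_map by auto
        hence "h = h'" unfolding h_def by auto
        thus False using q(3) h' by simp
      qed
      moreover have "map Inl q \<in> F" unfolding F_def FS_def using q(1) xX by blast
      ultimately show ?thesis using e(1) by auto
    qed
  qed
  have twice_sep: "\<exists>p\<in>F. e \<in> edges_of p \<and> f \<notin> edges_of p"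
    if e: "twice e c d" and f: "f \<in> all_edges vertices" and ne: "e \<noteq> f" for e f c d
  proof -
    have "\<exists>i. e \<in> edges_of (translate i) \<and> f \<notin> edges_of (translate i)"
    using f
    proof (cases rule: vertex_edge_cases)
      case (inner w w')
      have "e \<in> edges_of (translate c)" using twice_iff[OF e, of c] by simp
      thus ?thesis using inner_edge_notin inner(1) by blast
    next
      case (two c' d')
      thus ?thesis using twice_separated e ne by blast
    next
      case (one a b)
      thus ?thesis using twice_once_separated e by blast
    qed
    thus ?thesis using translate_rep unfolding F_def FT_def by (metis UnI1)
  qed
  have inner_sep: "\<exists>p\<in>F. e \<in> edges_of p \<and> f \<notin> edges_of p"
    if e: "e = {Inr w, Inr w'}" "w \<in> W" "w' \<in> W" "w \<noteq> w'" and ne: "e \<noteq> f" for e f w w'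
  proof -
    define h where "h = {y. Inr y \<in> f}"
    have eW: "{w, w'} \<in> all_edges W" unfolding all_edges_def using e by blast
    have "\<not> W \<subseteq> {w, w'}" using W3 card_mono[of "{w, w'}" W] card_insert_le_m1[of 2 "{w'}" w] by auto
    then obtain z where z: "z \<in> W" "z \<noteq> w" "z \<noteq> w'" by auto
    hence zW: "{w, z} \<in> all_edges W" "{w, z} \<noteq> {w, w'}" using e by (auto simp: all_edges_def doubleton_eq_iff)
    \<comment> \<open>If \<open>f\<close> is not an edge inside \<open>W\<close>, any other edge of
      \<open>W\<close> is put in its place; the third vertex \<open>z\<close> supplies one.\<close>
    define h' where "h' = (if f = Inr ` h \<and> h \<in> all_edges W then h else {w, z})"
    have "h' \<in> all_edges W" "h' \<noteq> {w, w'}" using zW e ne by (auto simp: h'_def)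
    then obtain r where r: "r \<in> R" "{w, w'} \<in> edges_of r" "h' \<notin> edges_of r"
      using R(1) eW unfolding separates_def by metis
    have "edges_of r \<subseteq> all_edges W"
      using R(1) r(1) by (intro edges_of_subset_all_edges) (auto simp: separates_def)
    have "(Inr ` {w, w'} :: (int + 'w) set) \<in> edges_of (map Inr r)" unfolding edges_of_map using r(2) by (rule imageI)
    moreover have "f \<notin> edges_of (map Inr r)"
    proof
      assume "f \<in> edges_of (map Inr r)"
      then obtain k where k: "f = Inr ` k" "k \<in> edges_of r" unfolding edges_of_map by auto
      hence "h = k" unfolding h_def by auto
      thus False using r(3) k \<open>edges_of r \<subseteq> all_edges W\<close> by (auto simp: h'_def)
    qed
    moreover have "map Inr r \<in> F" unfolding F_def FW_def using r(1) by blast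
    ultimately show ?thesis using e(1) by auto
  qed
  have "separates vertices F"
    unfolding separates_def
  proof (intro conjI ballI impI)
    show "finite F" using fin by (simp add: F_def)
  next
    fix p assume p: "p \<in> F"
    have "p \<noteq> [] \<and> distinct p \<and> set p \<subseteq> vertices"
    proof -
      consider "p \<in> FT" | "p \<in> FS" | "p \<in> FW" using p unfolding F_def by blast
      thus ?thesis
      proof cases
        case 1
        then obtain i where "p = translate i" by (auto simp: FT_def)
        thus ?thesis using set_translate[of i] distinct_translate[of i] B_ne by (simp add: translate_def)
      next
        case 2
        then obtain x q where "x \<in> X" "q \<in> Q x" "p = map Inl q" by (auto simp: FS_def)
        thus ?thesis using Q(3)[of x q] by (auto simp: distinct_map)
      next
        case 3
        then obtain q where "q \<in> R" "p = map Inr q" by (auto simp: FW_def)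
        thus ?thesis using R(1) by (auto simp: distinct_map separates_def)
      qed
    qed
    thus "p \<noteq> []" "distinct p" "set p \<subseteq> vertices" by blast+
  next
    fix e f assume e: "e \<in> all_edges vertices" and f: "f \<in> all_edges vertices" and ne: "e \<noteq> f"
    from e show "\<exists>p\<in>F. e \<in> edges_of p \<and> f \<notin> edges_of p"
    proof (cases rule: vertex_edge_cases)
      case (inner w w')
      thus ?thesis using inner_sep ne by metis
    next
      case (two c d)
      thus ?thesis by (rule twice_sep[OF _ f ne])
    next
      case (one a b)
      thus ?thesis using once ne by metis
    qed
  qed
  moreover have "finite vertices" using finite_W by simp
  moreover have "card vertices = nat N + card W"
    using finite_W by (subst card_Un_disjoint) (auto simp: card_image)
  ultimately have "ssp_Kn (nat N + card W) \<le> card F" using ssp_le by metis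
  also have "card F \<le> card FT + card FS + card FW"
    unfolding F_def using card_Un_le[of "FT \<union> FS" FW] card_Un_le[of FT FS] by linarith
  also have "card FT \<le> nat N" unfolding FT_def using card_image_le[of Z translate] by simp
  also have "card FS \<le> (\<Sum>x\<in>X. card (map Inl ` Q x :: (int + 'w) list set))"
    unfolding FS_def by (rule card_UN_le[OF finX])
  also have "\<dots> \<le> (\<Sum>x\<in>X. 3)"
    using Q(1,2) by (intro sum_mono) (meson card_image_le le_trans)
  also have "card FW \<le> ssp_Kn (card W)" unfolding FW_def using card_image_le[OF finR] R(2) by metis
  finally show ?thesis by (simp add: mult.commute)
qed

end

section \<open>Listing the residues by doubling orbits\<close>

lemma odd_dvd_power2_mult_cancel: "odd (N::int) \<Longrightarrow> N dvd 2 ^ i * z \<Longrightarrow> N dvd z"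
  by (metis coprime_dvd_mult_right_iff coprime_power_right_iff coprime_right_2_iff_odd)

lemma power2_cycle:
  assumes "odd (N::int)" "N > 1"
  shows "\<exists>k>0. N dvd 2 ^ k - 1"
proof -
  have "coprime 2 (nat N)" using assms by (simp add: coprime_left_2_iff_odd even_nat_iff)
  hence "[2 ^ totient (nat N) = 1] (mod nat N)" by (rule euler_theorem)
  hence "[int (2 ^ totient (nat N)) = int 1] (mod int (nat N))" by (simp only: cong_int_iff)
  hence "N dvd 2 ^ totient (nat N) - 1" using assms by (simp add: cong_iff_dvd_diff)
  moreover have "totient (nat N) > 0" using assms by simp
  ultimately show ?thesis by blast
qed

text \<open>The orbit is a cycle and may be cut anywhere. Listing it from 2 a to a places the cut
  after the prescribed element \<open>a\<close>.\<close>

lemma doubling_orbit_list: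
  assumes N: "odd (N::int)" "N > 1" and a: "0 < a" "a < N"
  obtains L where "distinct L" "L \<noteq> []" "last L = a" "set L \<subseteq> {0<..<N}"
    "\<And>x y. (x, y) \<in> steps L \<Longrightarrow> y = 2 * x mod N" "set L \<subseteq> (\<lambda>i. 2 ^ i * a mod N) ` UNIV"
    "\<And>x. x \<in> set L \<Longrightarrow> 2 * x mod N \<in> set L"
proof -
  define k where "k = (LEAST k. k > 0 \<and> N dvd (2 ^ k - 1) * a)"
  have ex: "\<exists>k. k > 0 \<and> N dvd (2 ^ k - 1) * a" using power2_cycle[OF N] by (metis dvd_mult2)
  have k: "k > 0" "N dvd (2 ^ k - 1) * a"
    using LeastI_ex[OF ex] unfolding k_def by blast+
  have k_min: "\<not> N dvd (2 ^ j - 1) * a" if "0 < j" "j < k" for j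
    using not_less_Least[of j "\<lambda>k. k > 0 \<and> N dvd (2 ^ k - 1) * a"] that unfolding k_def by blast
  define p where "p i = 2 ^ i * a mod N" for i
  define L where "L = map p [1..<Suc k]"
  have pk: "p k = a"
  proof -
    have "N dvd 2 ^ k * a - a" using k(2) by (simp add: left_diff_distrib)
    hence "2 ^ k * a mod N = a mod N" by (simp add: mod_eq_dvd_iff)
    thus ?thesis using a by (simp add: p_def)
  qed
  have inj: False if "i < j" "j \<le> k" "1 \<le> i" "p i = p j" for i j
  proof -
    have "N dvd 2 ^ j * a - 2 ^ i * a" using that(4) unfolding p_def by (metis mod_eq_dvd_iff)
    also have "2 ^ j * a - 2 ^ i * a = 2 ^ i * ((2 ^ (j - i) - 1) * a)"
      using that(1) by (simp add: algebra_simps flip: power_add)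
    finally have "N dvd (2 ^ (j - i) - 1) * a" by (rule odd_dvd_power2_mult_cancel[OF N(1)])
    moreover have "0 < j - i" "j - i < k" using that by auto
    ultimately show False using k_min by blast
  qed
  have p_Suc: "p (Suc i) = 2 * p i mod N" for i unfolding p_def by (simp add: mod_simps mult.assoc)
  have p_range: "p i \<in> {0<..<N}" for i
  proof -
    have "\<not> N dvd 2 ^ i * a" using odd_dvd_power2_mult_cancel[OF N(1)] a by (metis zdvd_not_zless)
    hence "p i \<noteq> 0" unfolding p_def by (simp add: dvd_eq_mod_eq_0)
    moreover have "0 \<le> p i" "p i < N" unfolding p_def using N(2) by simp_all
    ultimately show ?thesis by simp
  qed
  have "inj_on p (set [1..<Suc k])"
    by (intro linorder_inj_onI) (auto simp: less_Suc_eq_le simp del: upt_Suc dest: inj)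
  hence "distinct L" unfolding L_def by (simp add: distinct_map del: upt_Suc)
  moreover have "L \<noteq> []" "last L = a" unfolding L_def using k(1) pk by auto
  moreover have "set L \<subseteq> {0<..<N}" using p_range unfolding L_def by auto
  moreover have "y = 2 * x mod N" if "(x, y) \<in> steps L" for x y
    using that p_Suc unfolding steps_nth L_def by (auto simp: nth_append simp del: upt_Suc)
  moreover have "set L \<subseteq> (\<lambda>i. 2 ^ i * a mod N) ` UNIV" unfolding L_def p_def by auto
  moreover have "2 * x mod N \<in> set L" if x: "x \<in> set L" for x
  proof -
    obtain i where i: "1 \<le> i" "i \<le> k" "x = p i" using x unfolding L_def by fastforce
    show ?thesis
    proof (cases "i = k")
      case True
      have "p (Suc 0) = 2 * x mod N" unfolding i(3) True pk by (simp add: p_def)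
      moreover have "p (Suc 0) \<in> set L" unfolding L_def using k(1) by (auto simp del: upt_Suc)
      ultimately show ?thesis by simp
    next
      case False
      hence "p (Suc i) \<in> set L" using i unfolding L_def by (auto simp del: upt_Suc)
      thus ?thesis using p_Suc i(3) by simp
    qed
  qed
  ultimately show ?thesis by (rule that)
qed

text \<open>The terminals are the least elements of the orbits.\<close>

lemma doubling_list_aux:
  assumes N: "odd (N::int)" "N > 1"
  shows "A \<subseteq> {0<..<N} \<Longrightarrow> \<forall>x\<in>A. 2 * x mod N \<in> A \<Longrightarrow>
    \<exists>L T. distinct L \<and> set L = A \<and> T \<subseteq> A \<and> (L \<noteq> [] \<longrightarrow> last L \<in> T) \<and>
      (\<forall>x y. (x, y) \<in> steps L \<longrightarrow> x \<notin> T \<longrightarrow> y = 2 * x mod N) \<and>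
      (\<forall>t\<in>T. \<forall>k. t \<le> 2 ^ k * t mod N) \<and> (\<forall>t\<in>T. \<forall>t'\<in>T. \<forall>k. t' = 2 ^ k * t mod N \<longrightarrow> t = t')"
proof (induction "card A" arbitrary: A rule: less_induct)
  case less
  have pow_closed: "2 ^ k * x mod N \<in> C" if "x \<in> C" "C \<subseteq> {0<..<N}" "\<forall>x\<in>C. 2 * x mod N \<in> C" for C k x
  proof (induction k)
    case 0
    have "x mod N = x" using that by (intro mod_pos_pos_trivial) auto
    thus ?case using that by simp
  next
    case (Suc k)
    have "2 ^ Suc k * x mod N = 2 * (2 ^ k * x mod N) mod N" by (simp add: mod_simps mult.assoc)
    thus ?case using that(3) Suc by simp
  qed
  have finA: "finite A" using less.prems(1) by (rule finite_subset) simp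
  show ?case
  proof (cases "A = {}")
    case True
    thus ?thesis by (intro exI[of _ "[]"] exI[of _ "{}"]) simp
  next
    case False
    \<comment> \<open>The minimum of the remaining residues is the minimum of its own orbit, as
      \<open>A\<close> is closed under doubling.\<close>
    define a where "a = Min A"
    have a: "a \<in> A" "\<And>x. x \<in> A \<Longrightarrow> a \<le> x" using finA False by (auto simp: a_def)
    have a_range: "0 < a" "a < N" using a(1) less.prems(1) by auto
    obtain L where L: "distinct L" "L \<noteq> []" "last L = a" "set L \<subseteq> {0<..<N}"
      "\<And>x y. (x, y) \<in> steps L \<Longrightarrow> y = 2 * x mod N" "set L \<subseteq> (\<lambda>i. 2 ^ i * a mod N) ` UNIV"
      "\<forall>x\<in>set L. 2 * x mod N \<in> set L"
      using doubling_orbit_list[OF N a_range] by (metis (no_types, lifting))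
    have LA: "set L \<subseteq> A" using L(6) pow_closed[OF a(1) less.prems] by auto
    have aL: "a \<in> set L" using L(2,3) last_in_set by metis
    let ?dbl = "\<lambda>x. 2 * x mod N"
    have inj: "x = y" if "?dbl x = ?dbl y" "x \<in> {0<..<N}" "y \<in> {0<..<N}" for x y
    proof -
      have "N dvd 2 ^ 1 * (x - y)" using that(1) by (simp add: mod_eq_dvd_iff algebra_simps)
      hence "N dvd x - y" by (rule odd_dvd_power2_mult_cancel[OF N(1)])
      hence "x mod N = y mod N" by (simp add: mod_eq_dvd_iff)
      thus ?thesis using that by simp
    qed
    \<comment> \<open>An injective self-map of a finite set is onto. Hence halves of orbit elements
      stay in the orbit, and the complement is again closed under doubling.\<close>
    have "?dbl ` set L = set L"
    proof (rule endo_inj_surj)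
      show "inj_on ?dbl (set L)" using inj L(4) by (intro inj_onI) blast
    qed (use L(7) in auto)
    hence halve: "x \<in> set L" if "?dbl x \<in> set L" "x \<in> {0<..<N}" for x
      using inj that L(4) by (metis (no_types, lifting) imageE subsetD)
    let ?A' = "A - set L"
    have closed': "\<forall>x\<in>?A'. 2 * x mod N \<in> ?A'"
      using halve less.prems by blast
    have A'_less: "card ?A' < card A" using finA LA aL a(1) by (intro psubset_card_mono) auto
    have A'_sub: "?A' \<subseteq> {0<..<N}" using less.prems(1) by blast
    note less.hyps[OF A'_less A'_sub closed']
    then obtain L' T where L': "distinct L'" "set L' = ?A'" "T \<subseteq> ?A'" "L' \<noteq> [] \<longrightarrow> last L' \<in> T"
      and steps_L': "\<forall>x y. (x, y) \<in> steps L' \<longrightarrow> x \<notin> T \<longrightarrow> y = 2 * x mod N"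
      and T_min: "\<forall>t\<in>T. \<forall>k. t \<le> 2 ^ k * t mod N"
      and T_uniq: "\<forall>t\<in>T. \<forall>t'\<in>T. \<forall>k. t' = 2 ^ k * t mod N \<longrightarrow> t = t'"
      by (elim exE conjE) (rule that; assumption)
    have pow_L: "2 ^ k * a mod N \<in> set L" for k using pow_closed[OF aL L(4,7)] .
    have pow_A': "2 ^ k * t mod N \<in> ?A'" if "t \<in> T" for t k
      using pow_closed[OF _ _ closed'] that L'(3) less.prems(1) by blast
    have steps_app: "y = 2 * x mod N" if "(x, y) \<in> steps (L @ L')" "x \<notin> insert a T" for x y
    proof (cases "L' = []")
      case True
      thus ?thesis using that L(5) by simp
    next
      case False
      thus ?thesis using that L(5) steps_L' L(2,3) by (auto simp: steps_append)
    qed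
    show ?thesis
    proof (intro exI[of _ "L @ L'"] exI[of _ "insert a T"] conjI)
      show "distinct (L @ L')" using L(1) L'(1,2) by auto
      show "set (L @ L') = A" using L'(2) LA by auto
      show "insert a T \<subseteq> A" using a(1) L'(3) by auto
      show "L @ L' \<noteq> [] \<longrightarrow> last (L @ L') \<in> insert a T" using L(3) L'(4) by (auto simp: last_append)
      show "\<forall>x y. (x, y) \<in> steps (L @ L') \<longrightarrow> x \<notin> insert a T \<longrightarrow> y = 2 * x mod N"
        using steps_app by blast
      show "\<forall>t\<in>insert a T. \<forall>k. t \<le> 2 ^ k * t mod N"
        using T_min a(2) pow_L LA by auto
      show "\<forall>t\<in>insert a T. \<forall>t'\<in>insert a T. \<forall>k. t' = 2 ^ k * t mod N \<longrightarrow> t = t'"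
        using L'(3) T_uniq pow_L pow_A' aL by blast
    qed
  qed
qed

section \<open>Counting the doubling orbits\<close>

lemma card_multiples_le:
  assumes N: "(N::int) > 0" and q: "q > 0"
  shows "card {x \<in> {0..<N}. N dvd q * x} \<le> nat q"
proof -
  let ?A = "{x \<in> {0..<N}. N dvd q * x}" and ?f = "\<lambda>x. q * x div N"
  have eq: "?f x * N = q * x" if "x \<in> ?A" for x using that by simp
  have "inj_on ?f ?A"
  proof (rule inj_onI)
    fix x y assume "x \<in> ?A" "y \<in> ?A" "?f x = ?f y"
    hence "q * x = q * y" using eq by metis
    thus "x = y" using q by simp
  qed
  moreover have "?f ` ?A \<subseteq> {0..<q}"
  proof
    fix z assume "z \<in> ?f ` ?A"
    then obtain x where x: "x \<in> ?A" "z = ?f x" by blast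
    have zN: "z * N = q * x" using eq x by simp
    have "q * x < q * N" using x(1) q by simp
    hence "z < q" using zN N by (metis mult_less_cancel_right_pos)
    moreover have "0 \<le> z" using x q N by (simp add: pos_imp_zdiv_nonneg_iff)
    ultimately show "z \<in> {0..<q}" by simp
  qed
  ultimately have "card ?A \<le> card {0..<q}" by (rule card_inj_on_le) simp
  thus ?thesis by simp
qed

text \<open>A representative whose orbit length is at most l is annihilated by some 2 ^ k - 1 with k
  <= l, which leaves boundedly many. Each other one contributes l distinct residues, disjoint from
  those of the others, so there are at most N / l of them. The factor l avoids a division.\<close>

lemma card_orbit_representatives_le:
  fixes N :: int
  assumes N: "odd N" "N > 1" and T: "T \<subseteq> {0<..<N}"
    and uniq: "\<And>t t' k. t \<in> T \<Longrightarrow> t' \<in> T \<Longrightarrow> t' = 2 ^ k * t mod N \<Longrightarrow> t = t'"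
  shows "l * card T \<le> l * 2 ^ (l + 1) + nat N"
proof -
  define T1 where "T1 = {t\<in>T. \<exists>k\<in>{1..l}. N dvd (2 ^ k - 1) * t}"
  define T2 where "T2 = T - T1"
  have finT: "finite T" using T by (rule finite_subset) simp
  have "T1 \<subseteq> (\<Union>k\<in>{1..l}. {x \<in> {0..<N}. N dvd (2 ^ k - 1) * x})"
    using T unfolding T1_def by fastforce
  hence "card T1 \<le> card (\<Union>k\<in>{1..l}. {x \<in> {0..<N}. N dvd (2 ^ k - 1) * x})"
  proof (rule card_mono[rotated])
    have "finite {x \<in> {0..<N}. P x}" for P by (rule finite_subset[of _ "{0..<N}"]) auto
    thus "finite (\<Union>k\<in>{1..l}. {x \<in> {0..<N}. N dvd (2 ^ k - 1) * x})"
      by (intro finite_UN_I finite_atLeastAtMost)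
  qed
  also have "\<dots> \<le> (\<Sum>k\<in>{1..l}. card {x \<in> {0..<N}. N dvd (2 ^ k - 1) * x})"
    by (rule card_UN_le) simp
  also have "\<dots> \<le> (\<Sum>k\<in>{1..l}. 2 ^ k)"
  proof (rule sum_mono)
    fix k assume "k \<in> {1..l}"
    hence "(0::int) < 2 ^ k - 1" by simp
    hence "card {x \<in> {0..<N}. N dvd (2 ^ k - 1) * x} \<le> nat (2 ^ k - 1)"
      using N(2) by (intro card_multiples_le) auto
    also have "\<dots> \<le> 2 ^ k" by (simp add: nat_le_iff)
    finally show "card {x \<in> {0..<N}. N dvd (2 ^ k - 1) * x} \<le> 2 ^ k" .
  qed
  also have "\<dots> \<le> (\<Sum>k<Suc l. 2 ^ k)" by (rule sum_mono2) auto
  also have "\<dots> \<le> 2 ^ (l + 1)" 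
  proof -
    have "(\<Sum>k<m. 2 ^ k) \<le> (2::nat) ^ m" for m by (induction m) auto
    thus ?thesis by simp
  qed
  finally have c1: "card T1 \<le> 2 ^ (l + 1)" .
  have step: "t = t' \<and> i = j" if "t \<in> T2" "t' \<in> T2" "i \<le> j" "j < l"
    "2 ^ i * t mod N = 2 ^ j * t' mod N" for t t' i j
  proof -
    have "N dvd 2 ^ j * t' - 2 ^ i * t" using that(5) by (metis mod_eq_dvd_iff)
    also have "2 ^ j * t' - 2 ^ i * t = 2 ^ i * (2 ^ (j - i) * t' - t)"
      using that(3) by (simp add: algebra_simps flip: power_add)
    finally have d: "N dvd 2 ^ (j - i) * t' - t" by (rule odd_dvd_power2_mult_cancel[OF N(1)])
    have "t mod N = t" using that(1) T unfolding T2_def by (intro mod_pos_pos_trivial) auto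
    hence "t = 2 ^ (j - i) * t' mod N" using d by (metis mod_eq_dvd_iff)
    hence tt': "t' = t" using uniq[of t' t] that(1,2) by (auto simp: T2_def)
    have "i = j"
    proof (rule ccontr)
      assume "i \<noteq> j"
      hence "j - i \<in> {1..l}" using that by auto
      moreover have "N dvd (2 ^ (j - i) - 1) * t" using d tt' by (simp add: left_diff_distrib)
      ultimately have "t \<in> T1" using that(1) unfolding T1_def T2_def by blast
      thus False using that(1) by (simp add: T2_def)
    qed
    thus ?thesis using tt' by simp
  qed
  let ?f = "\<lambda>(t, i). 2 ^ i * t mod N"
  have "inj_on ?f (T2 \<times> {..<l})"
  proof (rule inj_onI)
    fix u v assume "u \<in> T2 \<times> {..<l}" "v \<in> T2 \<times> {..<l}" "?f u = ?f v"
    then obtain t i t' j where *: "u = (t, i)" "v = (t', j)" "t \<in> T2" "t' \<in> T2" "i < l" "j < l"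
      "2 ^ i * t mod N = 2 ^ j * t' mod N" by (cases u; cases v) auto
    show "u = v"
    proof (cases "i \<le> j")
      case True
      thus ?thesis using step[of t t' i j] * by simp
    next
      case False
      thus ?thesis using step[of t' t j i] * by simp
    qed
  qed
  moreover have "?f ` (T2 \<times> {..<l}) \<subseteq> {0..<N}" using N(2) by auto
  ultimately have "card (T2 \<times> {..<l}) \<le> card {0..<N}" by (rule card_inj_on_le) simp
  hence c2: "l * card T2 \<le> nat N" by (simp add: card_cartesian_product mult.commute)
  have "card T = card T1 + card T2"
    unfolding T2_def using finT by (subst card_Diff_subset) (auto simp: T1_def card_mono)
  hence "l * card T = l * card T1 + l * card T2" by (simp add: distrib_left)
  thus ?thesis using c1 c2 by (metis add_mono mult_le_mono2)
qed

lemma doubling_list: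
  fixes N :: int
  assumes N: "odd N" "N > 1"
  obtains L T where "distinct L" "set L = {0<..<N}" "T \<subseteq> {0<..<N}" "last L \<in> T"
    "\<And>x y. (x, y) \<in> steps L \<Longrightarrow> x \<notin> T \<Longrightarrow> y = 2 * x mod N"
    "\<And>t. t \<in> T \<Longrightarrow> N - t \<notin> T" "\<And>l. l * card T \<le> l * 2 ^ (l + 1) + nat N"
proof -
  have cl: "\<forall>x\<in>{0<..<N}. 2 * x mod N \<in> {0<..<N}"
  proof
    fix x assume that: "x \<in> {0<..<N}"
    have "\<not> N dvd 2 ^ 1 * x" using odd_dvd_power2_mult_cancel[OF N(1), of 1 x] that
        zdvd_not_zless[of x N] by auto
    hence "2 * x mod N \<noteq> 0" by (simp add: dvd_eq_mod_eq_0)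
    moreover have "0 \<le> 2 * x mod N" "2 * x mod N < N" using N(2) by simp_all
    ultimately show "2 * x mod N \<in> {0<..<N}" by simp
  qed
  obtain L T where L: "distinct L" "set L = {0<..<N}" "T \<subseteq> {0<..<N}" "L \<noteq> [] \<longrightarrow> last L \<in> T"
    and steps_L: "\<forall>x y. (x, y) \<in> steps L \<longrightarrow> x \<notin> T \<longrightarrow> y = 2 * x mod N"
    and T_min: "\<forall>t\<in>T. \<forall>k. t \<le> 2 ^ k * t mod N"
    and T_uniq: "\<forall>t\<in>T. \<forall>t'\<in>T. \<forall>k. t' = 2 ^ k * t mod N \<longrightarrow> t = t'"
    using doubling_list_aux[OF N subset_refl cl] by (elim exE conjE) (rule that; assumption)
  hence L5: "\<And>x y. (x, y) \<in> steps L \<Longrightarrow> x \<notin> T \<Longrightarrow> y = 2 * x mod N"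
    and L6: "\<And>t k. t \<in> T \<Longrightarrow> t \<le> 2 ^ k * t mod N"
    and L7: "\<And>t t' k. t \<in> T \<Longrightarrow> t' \<in> T \<Longrightarrow> t' = 2 ^ k * t mod N \<Longrightarrow> t = t'" by blast+
  have "1 \<in> set L" using L(2) N(2) by simp
  hence last: "last L \<in> T" using L(4) by auto
  \<comment> \<open>\<open>T\<close> will be part of \<open>X\<close> and must contain no negatives.
    Minimality in both orbits gives t <= 2 t mod N and N - t <= N - (2 t mod N), so 2 t and t would
    agree modulo \<open>N\<close>.\<close>
  have neg: "N - t \<notin> T" if t: "t \<in> T" for t
  proof
    assume t': "N - t \<in> T"
    have rng: "0 < t" "t < N" using t L(3) by auto
    have "\<not> N dvd 2 * t" using bspec[OF cl, of t] rng by (auto simp: dvd_eq_mod_eq_0)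
    have 1: "t \<le> 2 * t mod N" using L6[OF t, of 1] by simp
    have "2 ^ 1 * (N - t) mod N = (- (2 * t)) mod N"
    proof -
      have "2 ^ 1 * (N - t) = - (2 * t) + N * 2" by simp
      thus ?thesis by (metis mod_mult_self2)
    qed
    also have "\<dots> = N - 2 * t mod N"
      using \<open>\<not> N dvd 2 * t\<close> by (simp add: zmod_zminus1_eq_if dvd_eq_mod_eq_0)
    finally have "N - t \<le> N - 2 * t mod N" using L6[OF t', of 1] by simp
    hence "2 * t mod N = t mod N" using 1 rng by simp
    hence "N dvd 2 * t - t" by (simp only: mod_eq_dvd_iff)
    thus False using rng zdvd_not_zless[of t N] by simp
  qed
  show ?thesis
    using L7 by (intro that[OF L(1-3) last L5 neg] card_orbit_representatives_le[OF N L(3)])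
qed

section \<open>Choosing the detour vertices greedily\<close>

lemma dvd_combination: "(N::int) dvd a \<Longrightarrow> N dvd b \<Longrightarrow> z = k * a + l * b \<Longrightarrow> N dvd z"
  by simp

text \<open>A linear congruence with invertible leading coefficient excludes a single residue, so
  fewer than \<open>N\<close> of them leave one over.\<close>

lemma avoid_linear_congruences:
  fixes N :: int
  assumes N: "N > 0" and J: "finite J" "int (card J) < N" and cop: "\<And>c d. (c, d) \<in> J \<Longrightarrow> coprime N c"
  shows "\<exists>y\<in>{0..<N}. \<forall>c d. (c, d) \<in> J \<longrightarrow> \<not> N dvd c * y - d"
proof -
  let ?bad = "\<lambda>j. {y \<in> {0..<N}. N dvd fst j * y - snd j}"
  have "card (?bad j) \<le> 1" if "j \<in> J" for j
  proof -
    obtain c d where j: "j = (c, d)" by (cases j)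
    have "y = z" if "y \<in> ?bad j" "z \<in> ?bad j" for y z
    proof -
      have "N dvd c * y - d" "N dvd c * z - d" using that by (simp_all add: j)
      from dvd_combination[OF this, of "c * (y - z)" 1 "- 1"]
      have "N dvd c * (y - z)" by (simp add: algebra_simps)
      hence "N dvd y - z" using cop[of c d] \<open>j \<in> J\<close> j by (simp add: coprime_dvd_mult_right_iff)
      hence "y mod N = z mod N" by (simp add: mod_eq_dvd_iff)
      thus ?thesis using that by (simp add: j)
    qed
    moreover have "finite (?bad j)" by (rule finite_subset[of _ "{0..<N}"]) (auto simp: j)
    ultimately show ?thesis unfolding One_nat_def by (subst card_le_Suc0_iff_eq) blast+
  qed
  hence "(\<Sum>j\<in>J. card (?bad j)) \<le> (\<Sum>j\<in>J. 1)" by (intro sum_mono) blast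
  hence "card (\<Union>j\<in>J. ?bad j) \<le> card J" using card_UN_le[OF J(1), of ?bad] by simp
  define U where "U = (\<Union>j\<in>J. ?bad j)"
  have "card U < card {0..<N}" using \<open>card (\<Union>j\<in>J. ?bad j) \<le> card J\<close> J(2) N by (simp add: U_def)
  hence "U \<noteq> {0..<N}" by auto
  moreover have "U \<subseteq> {0..<N}" unfolding U_def by blast
  ultimately obtain y where y: "y \<in> {0..<N}" "y \<notin> U" by blast
  moreover have "\<not> N dvd c * y - d" if "(c, d) \<in> J" for c d
    using y that unfolding U_def by force
  ultimately show ?thesis by blast
qed

locale terminals =
  fixes N :: int and T :: "int set"
  assumes N_gt: "N > 1" and coprime_N: "coprime N 2" "coprime N 3" "coprime N 5" "coprime N 7"
    and T_sub: "T \<subseteq> {0<..<N}" and T_neg: "\<And>s t. s \<in> T \<Longrightarrow> t \<in> T \<Longrightarrow> \<not> N dvd s + t"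
begin

definition half :: "int \<Rightarrow> int" where
  "half x = x * ((N + 1) div 2) mod N"

text \<open>The differences in \<open>X\<close>: a terminal t loses its edge to 2 t, and replacing
  the residue s loses both the edge from s to 2 s and the edge from s/2 to s.\<close>

definition removed :: "int set \<Rightarrow> int set" where
  "removed S = T \<union> S \<union> half ` S"

definition avoids :: "int set \<Rightarrow> int \<Rightarrow> bool" where
  "avoids X s \<longleftrightarrow> s \<in> {0<..<N} \<and>
    (\<forall>x\<in>X. \<not> N dvd s - x \<and> \<not> N dvd s + x \<and> \<not> N dvd s - 2 * x \<and> \<not> N dvd s + 2 * x)"

text \<open>Disjointness from the halves of \<open>S\<close> means that no two consecutive residues
  of an orbit are replaced and that the predecessor of a replaced residue is not a terminal.\<close>

definition admissible :: "int set \<Rightarrow> bool" where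
  "admissible S \<longleftrightarrow> S \<subseteq> {0<..<N} \<and> S \<inter> T = {} \<and> (S \<union> T) \<inter> half ` S = {} \<and>
    (\<forall>x\<in>removed S. \<forall>y\<in>removed S. \<not> N dvd x + y)"

lemma cancel:
  "N dvd 2 * z \<longleftrightarrow> N dvd z" "N dvd 3 * z \<longleftrightarrow> N dvd z" "N dvd 4 * z \<longleftrightarrow> N dvd z"
proof -
  show 2: "N dvd 2 * z \<longleftrightarrow> N dvd z" for z using coprime_N(1) by (rule coprime_dvd_mult_right_iff)
  show "N dvd 3 * z \<longleftrightarrow> N dvd z" using coprime_N(2) by (rule coprime_dvd_mult_right_iff)
  show "N dvd 4 * z \<longleftrightarrow> N dvd z" using 2[of "2 * z"] 2[of z] by simp
qed

lemma half_dvd: "N dvd 2 * half x - x"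
proof -
  have "odd N" using coprime_N(1) coprime_right_2_iff_odd by blast
  define h where "h = (N + 1) div 2"
  have h: "2 * h = N + 1" unfolding h_def using \<open>odd N\<close> by (intro even_two_times_div_two) simp
  have "2 * (x * h) - x = x * (2 * h) - x" by simp
  also have "\<dots> = N * x" unfolding h by (simp add: algebra_simps)
  finally have "N dvd 2 * (x * h) - x" by simp
  moreover have "N dvd half x - x * h"
    unfolding half_def h_def[symmetric] by (simp add: mod_eq_dvd_iff[symmetric])
  ultimately show ?thesis by (rule dvd_combination[where k = 1 and l = 2]) simp
qed

lemma not_dvd: "x \<in> {0<..<N} \<Longrightarrow> \<not> N dvd x"
  by (auto dest: zdvd_not_zless)

lemma residue_eqI: "x \<in> {0<..<N} \<Longrightarrow> y \<in> {0<..<N} \<Longrightarrow> N dvd x - y \<Longrightarrow> x = y"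
proof -
  assume xy: "x \<in> {0<..<N}" "y \<in> {0<..<N}" "N dvd x - y"
  have "x mod N = y mod N" using xy(3) by (simp only: mod_eq_dvd_iff)
  thus ?thesis using xy(1,2) by simp
qed

lemma half_range:
  assumes "x \<in> {0<..<N}"
  shows "half x \<in> {0<..<N}"
proof -
  have "half x \<noteq> 0"
  proof
    assume "half x = 0"
    hence "N dvd x" using half_dvd[of x] by simp
    thus False using assms not_dvd by blast
  qed
  moreover have "0 \<le> half x" "half x < N" unfolding half_def using N_gt by simp_all
  ultimately show ?thesis by simp
qed

lemma removed_range: "S \<subseteq> {0<..<N} \<Longrightarrow> removed S \<subseteq> {0<..<N}"
  unfolding removed_def using T_sub half_range by blast

lemma finite_T: "finite T"
  using T_sub by (rule finite_subset) simp

lemma card_removed_le: "finite S \<Longrightarrow> card (removed S) \<le> card T + 2 * card S"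
proof -
  assume S: "finite S"
  have "card (removed S) \<le> card T + card S + card (half ` S)"
    unfolding removed_def using card_Un_le[of "T \<union> S" "half ` S"] card_Un_le[of T S] by linarith
  thus ?thesis using card_image_le[OF S, of half] by linarith
qed

lemma finite_admissible: "admissible S \<Longrightarrow> finite S"
  unfolding admissible_def by (auto intro: finite_subset[of _ "{0<..<N}"])

lemma removed_insert: "removed (insert s S) = removed S \<union> {s, half s}"
  unfolding removed_def by auto

lemma half_dvd_add: "N dvd half s + x \<Longrightarrow> N dvd s + 2 * x"
  using dvd_combination[of N "half s + x" "2 * half s - s" "s + 2 * x" 2 "- 1"] half_dvd[of s] by simp

lemma half_dvd_diff: "N dvd half s - x \<Longrightarrow> N dvd s - 2 * x"
  using dvd_combination[of N "half s - x" "2 * half s - s" "s - 2 * x" 2 "- 1"] half_dvd[of s] by simp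

text \<open>Both s and s/2 become new differences. Conditions on s/2 against x are doubled into
  conditions on s against 2 x, which is why \<open>avoids\<close> includes them.\<close>

lemma admissible_insert:
  assumes S: "admissible S" and s: "avoids (removed S) s"
  shows "admissible (insert s S)" "s \<notin> S"
proof -
  have sr: "s \<in> {0<..<N}" using s by (simp add: avoids_def)
  have s1: "\<not> N dvd s - x" "\<not> N dvd s + x" "\<not> N dvd s - 2 * x" "\<not> N dvd s + 2 * x"
    if "x \<in> removed S" for x using s that by (auto simp: avoids_def)
  have s0: "s \<notin> removed S" using s1(1)[of s] by auto
  thus "s \<notin> S" by (auto simp: removed_def)
  have h0: "half s \<notin> removed S" using s1(3)[of "half s"] half_dvd[of s] by (auto simp: dvd_diff_commute)
  have ns: "\<not> N dvd s" using not_dvd sr by blast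
  have sh: "\<not> N dvd half s - s"
  proof
    assume "N dvd half s - s"
    from half_dvd_diff[OF this] have "N dvd s - 2 * s" .
    thus False using ns by simp
  qed
  have shp: "\<not> N dvd s + half s"
  proof
    assume "N dvd s + half s"
    hence "N dvd s + 2 * s" using half_dvd_add[of s s] by (simp add: add.commute)
    thus False using ns cancel(2)[of s] by simp
  qed
  have hh: "\<not> N dvd half s + half s" 
    unfolding mult_2[symmetric] cancel by (rule not_dvd[OF half_range[OF sr]])
  have hx: "\<not> N dvd half s + x" if "x \<in> removed S" for x using half_dvd_add s1(4) that by blast
  have ss: "\<not> N dvd s + s" unfolding mult_2[symmetric] cancel by (rule ns)
  have old: "\<not> N dvd x + y" if "x \<in> removed S" "y \<in> removed S" for x y
    using S that by (auto simp: admissible_def)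
  have "\<not> N dvd x + y" if "x \<in> removed (insert s S)" "y \<in> removed (insert s S)" for x y
  proof -
    have "x \<in> removed S \<or> x = s \<or> x = half s" "y \<in> removed S \<or> y = s \<or> y = half s"
      using that by (auto simp: removed_insert)
    thus ?thesis using old s1(2) hx ss hh shp by (metis add.commute)
  qed
  moreover have "half s \<noteq> s" using sh by auto
  moreover have "s \<notin> half ` S" "s \<notin> T" "half s \<notin> S \<union> T" using s0 h0 by (auto simp: removed_def)
  ultimately show "admissible (insert s S)"
    using S sr unfolding admissible_def by auto
qed

section \<open>Greedy enlargement of the set of replaced residues\<close>

definition forbidden :: "int set \<Rightarrow> int set" where
  "forbidden X = {0} \<union> X \<union> uminus ` X \<union> (*) 2 ` X \<union> (*) (- 2) ` X"

lemma finite_forbidden: "finite X \<Longrightarrow> finite (forbidden X)"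
  unfolding forbidden_def by simp

lemma card_forbidden_le: "finite X \<Longrightarrow> card (forbidden X) \<le> 4 * card X + 1"
proof -
  assume X: "finite X"
  have "card (forbidden X) \<le> card {0::int} + card X + card (uminus ` X) + card ((*) 2 ` X) + card ((*) (- 2) ` X)"
    unfolding forbidden_def
    by (meson card_Un_le add_le_mono1 le_trans)
  thus ?thesis using card_image_le[OF X, of uminus] card_image_le[OF X, of "(*) 2"]
      card_image_le[OF X, of "(*) (- 2)"] by simp
qed

lemma avoidsI:
  assumes "s \<in> {0..<N}" "\<And>z. z \<in> forbidden X \<Longrightarrow> \<not> N dvd s - z"
  shows "avoids X s"
proof -
  have "s \<noteq> 0" using assms(2)[of 0] by (auto simp: forbidden_def)
  moreover have "\<not> N dvd s - x \<and> \<not> N dvd s + x \<and> \<not> N dvd s - 2 * x \<and> \<not> N dvd s + 2 * x" if "x \<in> X" for x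
    using assms(2)[of x] assms(2)[of "- x"] assms(2)[of "2 * x"] assms(2)[of "- 2 * x"] that
    by (auto simp: forbidden_def)
  ultimately show ?thesis using assms(1) unfolding avoids_def by auto
qed

lemma avoids_insert:
  assumes "avoids (removed S) s" "\<not> N dvd s - y" "\<not> N dvd s + y" "\<not> N dvd s - 2 * y" "\<not> N dvd s + 2 * y"
    "\<not> N dvd 2 * s - y" "\<not> N dvd 2 * s + y"
  shows "avoids (removed (insert y S)) s"
proof -
  have "\<not> N dvd s - half y"
    using assms(6) half_dvd_diff[of y s] by (auto simp: dvd_diff_commute)
  moreover have "\<not> N dvd s + half y"
    using assms(7) half_dvd_add[of y s] by (auto simp: add.commute)
  moreover have "\<not> N dvd s - 2 * half y"
  proof
    assume "N dvd s - 2 * half y"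
    hence "N dvd s - y" using dvd_combination[of N "s - 2 * half y" "2 * half y - y" "s - y" 1 1] half_dvd[of y] by simp
    thus False using assms(2) by simp
  qed
  moreover have "\<not> N dvd s + 2 * half y"
  proof
    assume "N dvd s + 2 * half y"
    hence "N dvd s + y" using dvd_combination[of N "s + 2 * half y" "2 * half y - y" "s + y" 1 "- 1"] half_dvd[of y] by simp
    thus False using assms(3) by simp
  qed
  ultimately show ?thesis using assms unfolding removed_insert avoids_def by auto
qed

text \<open>Padding: \<open>n\<close> prescribes the size of \<open>W\<close>, so the set of
  replaced residues must be able to reach a given size exactly.\<close>

lemma admissible_extend:
  assumes "admissible S" "card S \<le> m" "int (4 * (card T + 2 * m) + 1) < N"
  shows "\<exists>S'. S \<subseteq> S' \<and> admissible S' \<and> card S' = m"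
  using assms
proof (induction "m - card S" arbitrary: S)
  case 0
  thus ?case by auto
next
  case (Suc k)
  have finS: "finite S" using Suc.prems(1) by (rule finite_admissible)
  hence finR: "finite (removed S)" by (simp add: removed_def finite_T)
  let ?J = "Pair (1::int) ` forbidden (removed S)"
  have "card ?J \<le> card (forbidden (removed S))"
    by (intro card_image_le finite_forbidden finR)
  also have "\<dots> \<le> 4 * (card T + 2 * card S) + 1"
    by (rule order_trans[OF card_forbidden_le[OF finR]])
      (intro add_mono mult_le_mono2 card_removed_le[OF finS] order_refl)
  finally have "int (card ?J) < N" using Suc.prems(2,3) by simp
  moreover have "N > 0" "finite ?J" using N_gt finite_forbidden[OF finR] by simp_all
  moreover have "coprime N c" if "(c, d) \<in> ?J" for c d using that by auto
  ultimately obtain s where s: "s \<in> {0..<N}" "\<forall>c d. (c, d) \<in> ?J \<longrightarrow> \<not> N dvd c * s - d"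
    using avoid_linear_congruences[of N ?J] by blast
  have "\<not> N dvd s - z" if "z \<in> forbidden (removed S)" for z
    using s(2)[rule_format, of 1 z] that by simp
  hence "avoids (removed S) s" by (rule avoidsI[OF s(1)])
  note ins = admissible_insert[OF Suc.prems(1) this]
  have c: "card (insert s S) = Suc (card S)" using ins(2) finS by simp
  have "\<exists>S'. insert s S \<subseteq> S' \<and> admissible S' \<and> card S' = m"
    by (rule Suc.hyps(1)) (use ins c Suc.hyps(2) Suc.prems in auto)
  thus ?case by blast
qed

text \<open>Since 3 r = y - v, multiplying a condition between r and y by 3 turns it into a linear
  congruence in y alone.\<close>

lemma linked_avoids:
  assumes X: "avoids (removed S) r" and r: "N dvd y - v - 3 * r"
    and lin: "\<not> N dvd - 2 * y - v" "\<not> N dvd 4 * y - v" "\<not> N dvd - 5 * y - v" "\<not> N dvd 7 * y - v"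
      "\<not> N dvd - 1 * y - 2 * v" "\<not> N dvd 5 * y - 2 * v"
  shows "avoids (removed (insert y S)) r"
proof (rule avoids_insert[OF X]; rule notI)
  assume "N dvd r - y"
  from dvd_combination[OF r this, of "- 2 * y - v" 1 3] show False using lin(1) by simp
next
  assume "N dvd r + y"
  from dvd_combination[OF r this, of "4 * y - v" 1 3] show False using lin(2) by simp
next
  assume "N dvd r - 2 * y"
  from dvd_combination[OF r this, of "- 5 * y - v" 1 3] show False using lin(3) by simp
next
  assume "N dvd r + 2 * y"
  from dvd_combination[OF r this, of "7 * y - v" 1 3] show False using lin(4) by simp
next
  assume "N dvd 2 * r - y"
  from dvd_combination[OF r this, of "- 1 * y - 2 * v" 2 3] show False using lin(5) by simp
next
  assume "N dvd 2 * r + y"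
  from dvd_combination[OF r this, of "5 * y - 2 * v" 2 3] show False using lin(6) by simp
qed

text \<open>The three vertices of a detour from \<open>v\<close> through \<open>y\<close> to \<open>u\<close> are found by avoiding linear
  congruences in \<open>y\<close>; their coefficients are the reason for assuming \<open>N\<close> coprime to 2, 3, 5 and 7.\<close>

lemma detour_exists:
  assumes S: "admissible S" and vu: "\<not> N dvd u - v"
    and size: "int (12 * (card T + 2 * card S) + 20) < N"
  obtains y r r' where "N dvd y - v - 3 * r" "N dvd u - y - 3 * r'"
    "avoids (removed S) y" "avoids (removed (insert y S)) r" "avoids (removed (insert r (insert y S))) r'"
proof -
  define F where "F = forbidden (removed S)"
  have finS: "finite S" using S by (rule finite_admissible)
  hence finR: "finite (removed S)" by (simp add: removed_def finite_T)
  hence finF: "finite F" unfolding F_def by (rule finite_forbidden)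
  have cF: "card F \<le> 4 * (card T + 2 * card S) + 1"
    using card_forbidden_le[OF finR] card_removed_le[OF finS] unfolding F_def by simp
  \<comment> \<open>Six congruences keep r away from y, six keep r' away from y, and five keep r'
    away from r. The sixth condition of the last kind does not involve y: 3 (r + r') = u - v, which
    \<open>vu\<close> handles. With three copies of \<open>F\<close>, each of size at most 4 (card T
    + 2 card S) + 1, the total is the bound in \<open>size\<close>.\<close>
  define Cl :: "(int \<times> int) list" where
    "Cl = [(- 2, v), (4, v), (- 5, v), (7, v), (- 1, 2 * v), (5, 2 * v),
     (- 2, u), (4, u), (- 5, u), (7, u), (- 1, 2 * u), (5, 2 * u),
     (2, u + v), (3, u + 2 * v), (- 1, u - 2 * v), (3, 2 * u + v), (1, 2 * u - v)]"
  define C where "C = set Cl"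
  define J where "J = Pair 1 ` F \<union> (\<lambda>z. (1, v + 3 * z)) ` F \<union> (\<lambda>z. (1, u - 3 * z)) ` F \<union> C"
  have "finite C" by (simp add: C_def)
  hence finJ: "finite J" unfolding J_def using finF by simp
  have "card C \<le> length Cl" unfolding C_def by (rule card_length)
  also have "length Cl = 17" by (simp add: Cl_def)
  finally have cC: "card C \<le> 17" .
  let ?A1 = "Pair (1::int) ` F" and ?A2 = "(\<lambda>z. (1::int, v + 3 * z)) ` F"
    and ?A3 = "(\<lambda>z. (1::int, u - 3 * z)) ` F"
  have "card J \<le> card ?A1 + card ?A2 + card ?A3 + card C"
    unfolding J_def using card_Un_le[of "?A1 \<union> ?A2 \<union> ?A3" C] card_Un_le[of "?A1 \<union> ?A2" ?A3]
      card_Un_le[of ?A1 ?A2] by linarith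
  moreover have "card ?A1 \<le> card F" "card ?A2 \<le> card F" "card ?A3 \<le> card F"
    using finF by (rule card_image_le)+
  ultimately have "card J \<le> 3 * card F + 17" using cC by linarith
  hence cJ: "int (card J) < N" using cF size by simp
  have c4: "coprime N 4" using coprime_N(1) coprime_mult_right_iff[of N 2 2] by simp
  have cop: "coprime N c" if "(c, d) \<in> J" for c d
    using that coprime_N c4 unfolding J_def C_def Cl_def by auto
  have "N > 0" using N_gt by simp
  then obtain y where y: "y \<in> {0..<N}" and yJ: "\<forall>c d. (c, d) \<in> J \<longrightarrow> \<not> N dvd c * y - d"
    using avoid_linear_congruences[OF _ finJ cJ] cop by blast
  obtain i where "[3 * i = 1] (mod N)"
    using cong_solve_coprime_int[of 3 N] coprime_N(2) by (auto simp: coprime_commute)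
  hence i: "N dvd 3 * i - 1" by (simp add: cong_iff_dvd_diff)
  have solve: "N dvd z - 3 * (i * z mod N)" for z
  proof -
    have "N dvd i * z mod N - i * z" by (simp only: mod_eq_dvd_iff[symmetric] mod_mod_trivial)
    hence "N dvd z - 3 * (i * z mod N)"
      by (rule dvd_combination[OF dvd_mult2[OF i, of z], of _ _ "- 1" "- 3"]) (simp add: algebra_simps)
    thus ?thesis .
  qed
  define r where "r = i * (y - v) mod N"
  define r' where "r' = i * (u - y) mod N"
  have r: "N dvd y - v - 3 * r" and r': "N dvd u - y - 3 * r'"
    using solve[of "y - v"] solve[of "u - y"] by (simp_all add: r_def r'_def)
  have range: "r \<in> {0..<N}" "r' \<in> {0..<N}" unfolding r_def r'_def using N_gt by simp_all
  have Jmem: "(1, z) \<in> J" "(1, v + 3 * z) \<in> J" "(1, u - 3 * z) \<in> J" if "z \<in> F" for z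
    using that unfolding J_def by auto
  have C: "(c, d) \<in> C \<Longrightarrow> \<not> N dvd c * y - d" for c d using yJ unfolding J_def by blast
  have Cs: "\<not> N dvd - 2 * y - v" "\<not> N dvd 4 * y - v" "\<not> N dvd - 5 * y - v" "\<not> N dvd 7 * y - v"
    "\<not> N dvd - 1 * y - 2 * v" "\<not> N dvd 5 * y - 2 * v" "\<not> N dvd - 2 * y - u" "\<not> N dvd 4 * y - u"
    "\<not> N dvd - 5 * y - u" "\<not> N dvd 7 * y - u" "\<not> N dvd - 1 * y - 2 * u" "\<not> N dvd 5 * y - 2 * u"
    "\<not> N dvd 2 * y - (u + v)" "\<not> N dvd 3 * y - (u + 2 * v)" "\<not> N dvd - 1 * y - (u - 2 * v)" "\<not> N dvd 3 * y - (2 * u + v)"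
    "\<not> N dvd 1 * y - (2 * u - v)"
    by (rule C; simp add: C_def Cl_def)+
  have "avoids (removed S) y"
    using yJ[rule_format, OF Jmem(1)] by (intro avoidsI[OF y]) (simp add: F_def)
  moreover have "avoids (removed S) r"
  proof (rule avoidsI[OF range(1)])
    fix z assume "z \<in> forbidden (removed S)"
    hence *: "\<not> N dvd 1 * y - (v + 3 * z)" using yJ[rule_format, OF Jmem(2)] by (simp add: F_def)
    show "\<not> N dvd r - z"
    proof
      assume "N dvd r - z"
      from dvd_combination[OF r this, of "1 * y - (v + 3 * z)" 1 3] show False using * by simp
    qed
  qed
  hence ry: "avoids (removed (insert y S)) r"
    by (rule linked_avoids[OF _ r Cs(1-6)])
  moreover have "avoids (removed S) r'"
  proof (rule avoidsI[OF range(2)])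
    fix z assume "z \<in> forbidden (removed S)"
    hence *: "\<not> N dvd 1 * y - (u - 3 * z)" using yJ[rule_format, OF Jmem(3)] by (simp add: F_def)
    show "\<not> N dvd r' - z"
    proof
      assume "N dvd r' - z"
      from dvd_combination[OF r' this, of "1 * y - (u - 3 * z)" "- 1" "- 3"] show False using * by simp
    qed
  qed
  hence "avoids (removed (insert y S)) r'"
  proof -
    assume a: "avoids (removed S) r'"
    show ?thesis
    proof (rule avoids_insert[OF a]; rule notI)
      assume "N dvd r' - y"
      from dvd_combination[OF r' this, of "4 * y - u" "- 1" "- 3"] show False using Cs(8) by simp
    next
      assume "N dvd r' + y"
      from dvd_combination[OF r' this, of "- 2 * y - u" "- 1" "- 3"] show False using Cs(7) by simp
    next
      assume "N dvd r' - 2 * y"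
      from dvd_combination[OF r' this, of "7 * y - u" "- 1" "- 3"] show False using Cs(10) by simp
    next
      assume "N dvd r' + 2 * y"
      from dvd_combination[OF r' this, of "- 5 * y - u" "- 1" "- 3"] show False using Cs(9) by simp
    next
      assume "N dvd 2 * r' - y"
      from dvd_combination[OF r' this, of "5 * y - 2 * u" "- 2" "- 3"] show False using Cs(12) by simp
    next
      assume "N dvd 2 * r' + y"
      from dvd_combination[OF r' this, of "- 1 * y - 2 * u" "- 2" "- 3"] show False using Cs(11) by simp
    qed
  qed
  hence "avoids (removed (insert r (insert y S))) r'"
  proof (rule avoids_insert; intro notI)
    assume "N dvd r' - r"
    from dvd_combination[OF dvd_diff[OF r r'] this, of "2 * y - (u + v)" 1 "- 3"]
    show False using Cs(13) by simp
  next
    assume "N dvd r' + r"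
    from dvd_combination[OF dvd_add[OF r r'] this, of "u - v" 1 3] show False using vu by simp
  next
    assume "N dvd r' - 2 * r"
    from dvd_combination[OF dvd_diff[OF dvd_mult[OF r, of 2] r'] this, of "3 * y - (u + 2 * v)" 1 "- 3"]
    show False using Cs(14) by simp
  next
    assume "N dvd r' + 2 * r"
    from dvd_combination[OF dvd_add[OF dvd_mult[OF r, of 2] r'] this, of "- 1 * y - (u - 2 * v)" "- 1" "- 3"]
    show False using Cs(15) by simp
  next
    assume "N dvd 2 * r' - r"
    from dvd_combination[OF dvd_diff[OF r dvd_mult[OF r', of 2]] this, of "3 * y - (2 * u + v)" 1 "- 3"]
    show False using Cs(16) by simp
  next
    assume "N dvd 2 * r' + r"
    from dvd_combination[OF dvd_add[OF r dvd_mult[OF r', of 2]] this, of "1 * y - (2 * u - v)" "- 1" "- 3"]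
    show False using Cs(17) by simp
  qed
  ultimately show ?thesis using that[OF r r'] by blast
qed

lemma admissible_empty: "admissible {}"
  unfolding admissible_def removed_def using T_neg by auto

text \<open>Each jump adds three elements to \<open>S\<close>: y v must be replaced in its own
  orbit, and r v, r' v must become removed differences to serve as labels. The injectivity clauses
  make the detours disjoint and the labels distinct.\<close>

lemma detours_exist_aux:
  assumes "finite V" "\<forall>v\<in>V. \<not> N dvd nx v - v" "int (12 * (card T + 6 * card V) + 20) < N"
  shows "\<exists>S y r r'. admissible S \<and> card S = 3 * card V \<and> y ` V \<subseteq> S \<and> r ` V \<subseteq> S \<and> r' ` V \<subseteq> S \<and>
    (\<forall>v\<in>V. N dvd y v - v - 3 * r v \<and> N dvd nx v - y v - 3 * r' v) \<and>
    inj_on y V \<and> inj_on r V \<and> inj_on r' V \<and> r ` V \<inter> r' ` V = {}"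
  using assms
proof (induction V rule: finite_induct)
  case empty
  show ?case using admissible_empty by (intro exI[of _ "{}"]) simp
next
  case (insert v V)
  have IH_prems: "\<forall>v\<in>V. \<not> N dvd nx v - v" "int (12 * (card T + 6 * card V) + 20) < N"
    using insert.prems insert.hyps by simp_all
  obtain S y r r' where IH: "admissible S" "card S = 3 * card V" "y ` V \<subseteq> S" "r ` V \<subseteq> S" "r' ` V \<subseteq> S"
    "\<forall>v\<in>V. N dvd y v - v - 3 * r v \<and> N dvd nx v - y v - 3 * r' v"
    "inj_on y V" "inj_on r V" "inj_on r' V" "r ` V \<inter> r' ` V = {}"
    using insert.IH[OF IH_prems] by (elim exE conjE) (rule that; assumption)
  have size: "int (12 * (card T + 2 * card S) + 20) < N" using insert.prems(2) insert.hyps IH(2) by simp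
  obtain a b b' where new: "N dvd a - v - 3 * b" "N dvd nx v - a - 3 * b'"
    "avoids (removed S) a" "avoids (removed (insert a S)) b" "avoids (removed (insert b (insert a S))) b'"
    using detour_exists[OF IH(1) bspec[OF insert.prems(1) insertI1] size] by metis
  define S' where "S' = insert b' (insert b (insert a S))"
  note i1 = admissible_insert[OF IH(1) new(3)]
  note i2 = admissible_insert[OF i1(1) new(4)]
  note i3 = admissible_insert[OF i2(1) new(5)]
  have "finite S" using IH(1) by (rule finite_admissible)
  hence "card S' = 3 * card (insert v V)"
    unfolding S'_def using i1(2) i2(2) i3(2) IH(2) insert.hyps by simp
  moreover have "admissible S'" unfolding S'_def by (rule i3(1))
  moreover have im: "f(v := c) ` insert v V = insert c (f ` V)" for f :: "int \<Rightarrow> int" and c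
    using insert.hyps(2) by (auto simp: image_iff)
  moreover have inj: "inj_on (f(v := c)) (insert v V)" if "inj_on f V" "f ` V \<subseteq> S" "c \<notin> S" for f :: "int \<Rightarrow> int" and c
    using that insert.hyps(2) by (auto simp: inj_on_def)
  moreover have "inj_on (y(v := a)) (insert v V)" "inj_on (r(v := b)) (insert v V)" "inj_on (r'(v := b')) (insert v V)"
    using i1(2) i2(2) i3(2) inj[OF IH(7,3)] inj[OF IH(8,4)] inj[OF IH(9,5)] by blast+
  moreover have "insert b (r ` V) \<inter> insert b' (r' ` V) = {}"
    using IH(4,5,10) i2(2) i3(2) by auto
  moreover have "\<forall>w\<in>insert v V. N dvd (y(v := a)) w - w - 3 * (r(v := b)) w \<and>
      N dvd nx w - (y(v := a)) w - 3 * (r'(v := b')) w"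
    using IH(6) new(1,2) by auto
  moreover have "insert a (y ` V) \<subseteq> S'" "insert b (r ` V) \<subseteq> S'" "insert b' (r' ` V) \<subseteq> S'"
    using IH(3-5) unfolding S'_def by auto
  ultimately show ?case
    by (intro exI[of _ S'] exI[of _ "y(v := a)"] exI[of _ "r(v := b)"] exI[of _ "r'(v := b')"] conjI)
      (simp_all only: im)
qed

lemma detours_exist:
  assumes V: "finite V" "\<forall>v\<in>V. \<not> N dvd nx v - v"
    and m: "3 * card V \<le> m" "int (12 * (card T + 2 * m) + 20) < N"
  obtains S y r r' where "admissible S" "card S = m" "y ` V \<subseteq> S" "r ` V \<subseteq> S" "r' ` V \<subseteq> S"
    "\<forall>v\<in>V. N dvd y v - v - 3 * r v \<and> N dvd nx v - y v - 3 * r' v"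
    "inj_on y V" "inj_on r V" "inj_on r' V" "r ` V \<inter> r' ` V = {}"
proof -
  have "int (12 * (card T + 6 * card V) + 20) < N" using m by simp
  from detours_exist_aux[OF V this] obtain S y r r' where
    S: "admissible S" "card S = 3 * card V" "y ` V \<subseteq> S" "r ` V \<subseteq> S" "r' ` V \<subseteq> S"
    "\<forall>v\<in>V. N dvd y v - v - 3 * r v \<and> N dvd nx v - y v - 3 * r' v"
    "inj_on y V" "inj_on r V" "inj_on r' V" "r ` V \<inter> r' ` V = {}"
    by (elim exE conjE) (rule that; assumption)
  have "card S \<le> m" "int (4 * (card T + 2 * m) + 1) < N" using m S(2) by simp_all
  then obtain S' where S': "S \<subseteq> S'" "admissible S'" "card S' = m"
    using admissible_extend[OF S(1)] by blast
  show ?thesis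
    using S(3-5) S'(1) by (intro that[OF S'(2,3) _ _ _ S(6-10)]) auto
qed

end

section \<open>Assembling the base path\<close>

lemma distinct_concat_map:
  assumes "distinct xs" "\<And>x. x \<in> set xs \<Longrightarrow> distinct (f x)"
    "\<And>x y. x \<in> set xs \<Longrightarrow> y \<in> set xs \<Longrightarrow> x \<noteq> y \<Longrightarrow> set (f x) \<inter> set (f y) = {}"
  shows "distinct (concat (map f xs))"
  using assms
proof (induction xs)
  case (Cons x xs)
  have "distinct (concat (map f xs))" using Cons by (intro Cons.IH) auto
  moreover have "set (f x) \<inter> set (f z) = {}" if "z \<in> set xs" for z
    using Cons.prems(1) that by (intro Cons.prems(3)) auto
  moreover have "distinct (f x)" using Cons.prems(2) by simp
  ultimately show ?case by auto
qed simp

lemma steps_successor: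
  assumes "x \<in> set xs" "x \<noteq> last xs"
  shows "\<exists>y. (x, y) \<in> steps xs"
proof -
  obtain i where i: "i < length xs" "x = xs ! i" using assms(1) by (metis in_set_conv_nth)
  have "Suc i < length xs"
  proof (rule ccontr)
    assume "\<not> Suc i < length xs"
    hence "i = length xs - 1" using i by simp
    thus False using i assms(2) by (metis last_conv_nth length_0_conv not_less_zero)
  qed
  thus ?thesis unfolding steps_nth using i by blast
qed

lemma steps_last:
  assumes "distinct xs"
  shows "(last xs, y) \<notin> steps xs"
proof
  assume "(last xs, y) \<in> steps xs"
  then obtain i where i: "Suc i < length xs" "last xs = xs ! i" unfolding steps_nth by auto
  hence "last xs = xs ! (length xs - 1)" by (intro last_conv_nth) auto
  hence "i = length xs - 1" using i assms by (simp add: nth_eq_iff_index_eq)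
  thus False using i by simp
qed

locale assembly = terminals +
  fixes L :: "int list" and V S :: "int set" and nx y r r' :: "int \<Rightarrow> int"
  assumes L_distinct: "distinct L" and L_set: "set L = {0<..<N}" and L_last: "last L \<in> T"
    and L_steps: "\<And>x y. (x, y) \<in> steps L \<Longrightarrow> x \<notin> T \<Longrightarrow> y = 2 * x mod N"
    and V_def: "V = T - {last L}" and nx: "\<And>v. v \<in> V \<Longrightarrow> (v, nx v) \<in> steps L"
    and S_admissible: "admissible S" and y_S: "y ` V \<subseteq> S" and r_S: "r ` V \<subseteq> S" and r'_S: "r' ` V \<subseteq> S"
    and links: "\<And>v. v \<in> V \<Longrightarrow> N dvd y v - v - 3 * r v" "\<And>v. v \<in> V \<Longrightarrow> N dvd nx v - y v - 3 * r' v"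
    and y_inj: "inj_on y V" and r_inj: "inj_on r V" and r'_inj: "inj_on r' V"
    and r_disjoint: "r ` V \<inter> r' ` V = {}"
begin

definition dbl :: "int \<Rightarrow> int" where "dbl x = 2 * x mod N"

text \<open>(s, 0) takes the place of the residue s; (v, 1) and (v, 2) stand before and after y v on
  the detour from v to nx v.\<close>

definition W :: "(int \<times> nat) set" where
  "W = S \<times> {0} \<union> V \<times> {1, 2}"

definition \<alpha> :: "int \<times> nat \<Rightarrow> int" where
  "\<alpha> = (\<lambda>(x, k). if k = 0 then half x else if k = 1 then x else y x)"

definition \<beta> :: "int \<times> nat \<Rightarrow> int" where
  "\<beta> = (\<lambda>(x, k). if k = 0 then dbl x else if k = 1 then y x else nx x)"

text \<open>Substitutes are labelled by halves of \<open>S\<close> and detours by elements of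
  \<open>S\<close>; these two sets are disjoint, which is what \<open>g_inj\<close> rests
  on.\<close>

definition g :: "int \<times> nat \<Rightarrow> int" where
  "g = (\<lambda>(x, k). if k = 0 then half x else if k = 1 then r x else r' x)"

definition \<sigma> :: "int \<Rightarrow> int + int \<times> nat" where
  "\<sigma> x = (if x \<in> S then Inr (x, 0) else Inl x)"

text \<open>A residue in \<open>S\<close> is replaced by a new vertex, which frees it for use as a detour vertex.\<close>

definition block :: "int \<Rightarrow> (int + int \<times> nat) list" where
  "block x = \<sigma> x # (if x \<in> V then [Inr (x, 1), Inl (y x), Inr (x, 2)] else [])"

definition B :: "(int + int \<times> nat) list" where
  "B = concat (map block L)"

lemma S_sub: "S \<subseteq> {0<..<N}" and S_T: "S \<inter> T = {}" and half_S: "(S \<union> T) \<inter> half ` S = {}"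
  and removed_neg: "\<And>x z. x \<in> removed S \<Longrightarrow> z \<in> removed S \<Longrightarrow> \<not> N dvd x + z"
  using S_admissible by (auto simp: admissible_def)

lemma V_T: "V \<subseteq> T" and V_sub: "V \<subseteq> {0<..<N}" and V_S: "v \<in> V \<Longrightarrow> v \<notin> S"
  using V_def T_sub S_T by auto

section \<open>Doubling and halving along the list\<close>

lemma dbl_dvd: "N dvd dbl x - 2 * x"
  unfolding dbl_def by (simp only: mod_eq_dvd_iff[symmetric] mod_mod_trivial)

lemma dbl_range: "x \<in> {0<..<N} \<Longrightarrow> dbl x \<in> {0<..<N}"
proof -
  assume "x \<in> {0<..<N}"
  hence "\<not> N dvd 2 * x" using not_dvd by (simp add: cancel)
  hence "dbl x \<noteq> 0" by (simp add: dbl_def dvd_eq_mod_eq_0)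
  moreover have "0 \<le> dbl x" "dbl x < N" unfolding dbl_def using N_gt by simp_all
  ultimately show ?thesis by simp
qed

lemma half_dbl: "x \<in> {0<..<N} \<Longrightarrow> half (dbl x) = x"
proof -
  assume x: "x \<in> {0<..<N}"
  have "N dvd 2 * (half (dbl x) - x)"
    using dvd_combination[OF half_dvd[of "dbl x"] dbl_dvd[of x], of "2 * (half (dbl x) - x)" 1 1] by simp
  hence "N dvd half (dbl x) - x" by (simp only: cancel)
  thus ?thesis using x half_range dbl_range by (intro residue_eqI) blast+
qed

lemma dbl_half: "x \<in> {0<..<N} \<Longrightarrow> dbl (half x) = x"
proof -
  assume x: "x \<in> {0<..<N}"
  have "N dvd dbl (half x) - x"
    using dvd_combination[OF half_dvd[of x] dbl_dvd[of "half x"], of "dbl (half x) - x" 1 1] by simp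
  thus ?thesis using x half_range dbl_range by (intro residue_eqI) blast+
qed

lemma finite_S: "finite S" and finite_V: "finite V"
  using S_sub V_sub by (auto intro: finite_subset[of _ "{0<..<N}"])

lemma finite_W: "finite W"
  unfolding W_def using finite_S finite_V by simp

lemma card_W: "card W = card S + 2 * card V"
proof -
  have "V \<times> {1::nat, 2} \<inter> S \<times> {0} = {}" by auto
  hence "card W = card (S \<times> {0::nat}) + card (V \<times> {1::nat, 2})"
    unfolding W_def using finite_S finite_V by (intro card_Un_disjoint) auto
  thus ?thesis by (simp add: card_cartesian_product)
qed

text \<open>If nx v were replaced, its half would be no terminal and hence would precede it in the
  list, where the terminal v already stands.\<close>

lemma nx_notin_S: "v \<in> V \<Longrightarrow> nx v \<notin> S"
proof
  assume v: "v \<in> V" and S: "nx v \<in> S"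
  define t where "t = half (nx v)"
  have t: "t \<in> {0<..<N}" "dbl t = nx v" unfolding t_def using S S_sub half_range dbl_half by blast+
  have "t \<notin> T" using half_S S unfolding t_def by blast
  hence "t \<noteq> last L" using L_last by auto
  then obtain u where "(t, u) \<in> steps L" using steps_successor t L_set by metis
  moreover from this have "u = nx v" using L_steps \<open>t \<notin> T\<close> t(2) by (auto simp: dbl_def)
  ultimately have "t = v" using steps_injective[OF L_distinct] nx[OF v] by blast
  thus False using \<open>t \<notin> T\<close> v V_T by blast
qed

lemma step_dbl: "x \<in> {0<..<N} \<Longrightarrow> x \<notin> T \<Longrightarrow> (x, dbl x) \<in> steps L"
proof -
  assume x: "x \<in> {0<..<N}" "x \<notin> T"
  hence "x \<noteq> last L" using L_last by auto
  then obtain u where "(x, u) \<in> steps L" using steps_successor x L_set by metis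
  thus ?thesis using L_steps x by (auto simp: dbl_def)
qed

lemma steps_L: "steps L = (\<lambda>x. (x, dbl x)) ` ({0<..<N} - T) \<union> (\<lambda>v. (v, nx v)) ` V"
proof (intro subset_antisym subsetI)
  fix p assume "p \<in> steps L"
  then obtain x z where p: "p = (x, z)" "(x, z) \<in> steps L" by (cases p) auto
  hence x: "x \<in> {0<..<N}" using steps_in_set L_set by metis
  show "p \<in> (\<lambda>x. (x, dbl x)) ` ({0<..<N} - T) \<union> (\<lambda>v. (v, nx v)) ` V"
  proof (cases "x \<in> T")
    case True
    hence "x \<in> V" using p steps_last[OF L_distinct] by (auto simp: V_def)
    moreover from this have "z = nx x" using nx p(2) steps_functional[OF L_distinct] by blast
    ultimately show ?thesis using p(1) by auto
  next
    case False
    thus ?thesis using L_steps p x by (auto simp: dbl_def)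
  qed
qed (use step_dbl nx in auto)

section \<open>Edges of the concatenated blocks\<close>

lemma hd_block: "hd (block x) = \<sigma> x" and last_block: "last (block x) = (if x \<in> V then Inr (x, 2) else \<sigma> x)"
  and block_ne: "block x \<noteq> []"
  by (auto simp: block_def)

lemma B_distinct: "distinct B"
  unfolding B_def
proof (rule distinct_concat_map[OF L_distinct])
  fix x
  show "distinct (block x)" using y_S V_S by (auto simp: block_def \<sigma>_def)
next
  fix x z :: int assume "x \<noteq> z"
  moreover have "y x \<noteq> y z" if "x \<in> V" "z \<in> V" using y_inj that \<open>x \<noteq> z\<close> by (auto dest: inj_onD)
  moreover have "y u \<in> S" if "u \<in> V" for u using y_S that by auto
  ultimately show "set (block x) \<inter> set (block z) = {}"
    by (auto simp: block_def \<sigma>_def)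
qed

lemma B_set: "set B \<subseteq> Inl ` {0..<N} \<union> Inr ` W"
proof -
  have "set (block x) \<subseteq> Inl ` {0..<N} \<union> Inr ` W" if "x \<in> {0<..<N}" for x
  proof -
    have "y x \<in> {0<..<N}" if "x \<in> V" using that y_S S_sub by blast
    thus ?thesis using that unfolding block_def \<sigma>_def W_def by auto
  qed
  thus ?thesis unfolding B_def set_concat set_map L_set by blast
qed

lemma B_ne: "B \<noteq> []"
proof -
  have "1 \<in> set L" using L_set N_gt by simp
  thus ?thesis unfolding B_def using block_ne by auto
qed

lemma edges_B_blocks: "edges_of B =
  (\<lambda>x. {\<sigma> x, \<sigma> (dbl x)}) ` ({0<..<N} - T) \<union> (\<lambda>v. {Inr (v, 2), \<sigma> (nx v)}) ` V \<union>
  (\<Union>v\<in>V. {{Inl v, Inr (v, 1)}, {Inr (v, 1), Inl (y v)}, {Inl (y v), Inr (v, 2)}})"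
proof -
  have V_L: "V \<subseteq> set L" using V_sub L_set by simp
  have blk: "steps (block x) = (if x \<in> V then {(Inl x, Inr (x, 1)), (Inr (x, 1), Inl (y x)), (Inl (y x), Inr (x, 2))} else {})" for x
    using V_S[of x] by (auto simp: block_def \<sigma>_def)
  have "steps B = (\<Union>x\<in>set L. steps (block x)) \<union> (\<lambda>(x, y). (last (block x), hd (block y))) ` steps L"
    unfolding B_def by (rule steps_concat_map) (rule block_ne)
  also have "(\<Union>x\<in>set L. steps (block x)) =
      (\<Union>v\<in>V. {(Inl v, Inr (v, 1)), (Inr (v, 1), Inl (y v)), (Inl (y v), Inr (v, 2))})"
    unfolding blk using V_L by (auto split: if_splits)
  also have "(\<lambda>(x, y). (last (block x), hd (block y))) ` steps L =
      (\<lambda>x. (\<sigma> x, \<sigma> (dbl x))) ` ({0<..<N} - T) \<union> (\<lambda>v. (Inr (v, 2), \<sigma> (nx v))) ` V"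
  proof -
    have "(\<lambda>x. (last (block x), hd (block (dbl x)))) ` ({0<..<N} - T) = (\<lambda>x. (\<sigma> x, \<sigma> (dbl x))) ` ({0<..<N} - T)"
      using V_T by (intro image_cong) (auto simp: hd_block last_block)
    moreover have "(\<lambda>v. (last (block v), hd (block (nx v)))) ` V = (\<lambda>v. (Inr (v, 2), \<sigma> (nx v))) ` V"
      by (intro image_cong) (auto simp: hd_block last_block)
    ultimately show ?thesis unfolding steps_L image_Un image_image by simp
  qed
  finally show ?thesis unfolding edges_of_def by (simp add: image_Un image_UN image_image Un_ac)
qed

lemma W_image: "f ` W = (\<lambda>x. f (x, 0)) ` S \<union> (\<lambda>v. f (v, 1)) ` V \<union> (\<lambda>v. f (v, 2)) ` V"
  unfolding W_def by (auto simp: image_iff)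

text \<open>At most one of x and 2 x is replaced. A replaced s therefore turns its two orbit edges
  into edges from (s, 0) to s/2 and to 2 s, and all other doubling edges survive.\<close>

lemma edges_dbl: "(\<lambda>x. {\<sigma> x, \<sigma> (dbl x)}) ` ({0<..<N} - T) =
  (\<lambda>x. {Inl x, Inl (dbl x)}) ` ({0<..<N} - removed S) \<union>
  (\<lambda>s. {Inl (half s), Inr (s, 0)}) ` S \<union> (\<lambda>s. {Inl (dbl s), Inr (s, 0)}) ` S"
  (is "?f ` _ = ?A \<union> ?H \<union> ?D")
proof (intro subset_antisym subsetI)
  fix e assume "e \<in> ?f ` ({0<..<N} - T)"
  then obtain x where x: "x \<in> {0<..<N}" "x \<notin> T" "e = {\<sigma> x, \<sigma> (dbl x)}" by blast
  have not_both: "x \<notin> S" if "dbl x \<in> S" using half_S that half_dbl[OF x(1)] by force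
  show "e \<in> ?A \<union> ?H \<union> ?D"
  proof (cases "x \<in> S")
    case True
    hence "e = {Inl (dbl x), Inr (x, 0)}" using not_both x(3) by (auto simp: \<sigma>_def)
    thus ?thesis using True by blast
  next
    case False
    show ?thesis
    proof (cases "dbl x \<in> S")
      case True
      hence "e = {Inl (half (dbl x)), Inr (dbl x, 0)}" using False x(3) half_dbl[OF x(1)] by (simp add: \<sigma>_def)
      thus ?thesis using True by blast
    next
      case dS: False
      have "x \<notin> half ` S" using dbl_half S_sub dS by auto
      hence "x \<in> {0<..<N} - removed S" using x False by (simp add: removed_def)
      moreover have "e = {Inl x, Inl (dbl x)}" using False dS x(3) by (simp add: \<sigma>_def)
      ultimately show ?thesis by blast
    qed
  qed
next
  fix e assume "e \<in> ?A \<union> ?H \<union> ?D"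
  then consider x where "x \<in> {0<..<N} - removed S" "e = {Inl x, Inl (dbl x)}"
    | s where "s \<in> S" "e = {Inl (half s), Inr (s, 0)}" | s where "s \<in> S" "e = {Inl (dbl s), Inr (s, 0)}"
    by blast
  thus "e \<in> ?f ` ({0<..<N} - T)"
  proof cases
    case 1
    have "dbl x \<notin> S"
    proof
      assume "dbl x \<in> S"
      hence "half (dbl x) \<in> half ` S" by (rule imageI)
      thus False using 1(1) half_dbl by (auto simp: removed_def)
    qed
    hence "e = ?f x" using 1 by (simp add: \<sigma>_def removed_def)
    thus ?thesis using 1(1) by (simp add: removed_def)
  next
    case 2
    have s: "s \<in> {0<..<N}" using 2 S_sub by blast
    have "half s \<notin> S \<union> T" using half_S 2(1) by blast
    hence "e = ?f (half s)" "half s \<in> {0<..<N} - T"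
      using 2 half_range[OF s] by (simp_all add: \<sigma>_def dbl_half[OF s])
    thus ?thesis by blast
  next
    case 3
    have s: "s \<in> {0<..<N}" "s \<notin> T" using 3 S_sub S_T by blast+
    have "dbl s \<notin> S" using half_S half_dbl[OF s(1)] 3(1) by force
    hence "e = ?f s" using 3 by (auto simp: \<sigma>_def)
    thus ?thesis using s by blast
  qed
qed

lemma B_edges: "edges_of B = (\<lambda>x. {Inl x, Inl (2 * x mod N)}) ` ({0<..<N} - removed S) \<union>
    (\<lambda>w. {Inl (\<alpha> w), Inr w}) ` W \<union> (\<lambda>w. {Inl (\<beta> w), Inr w}) ` W"
proof -
  have "(\<lambda>v. {Inr (v, 2), \<sigma> (nx v)}) ` V = (\<lambda>v. {Inl (nx v), Inr (v, 2)}) ` V"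
    by (intro image_cong) (auto simp: \<sigma>_def nx_notin_S)
  moreover have "(\<Union>v\<in>V. {{Inl v, Inr (v, 1)}, {Inr (v, 1), Inl (y v)}, {Inl (y v), Inr (v, 2)}}) =
    (\<lambda>v. {Inl v, Inr (v, 1::nat)}) ` V \<union> (\<lambda>v. {Inl (y v), Inr (v, 1)}) ` V \<union> (\<lambda>v. {Inl (y v), Inr (v, 2)}) ` V"
    by (auto simp: insert_commute)
  ultimately show ?thesis
    unfolding edges_B_blocks edges_dbl W_image by (simp add: \<alpha>_def \<beta>_def dbl_def Un_ac)
qed

lemma beta: "w \<in> W \<Longrightarrow> [\<beta> w = \<alpha> w + 3 * g w] (mod N)"
proof -
  assume "w \<in> W"
  then consider s where "s \<in> S" "w = (s, 0)" | v where "v \<in> V" "w = (v, 1)" | v where "v \<in> V" "w = (v, 2)"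
    unfolding W_def by auto
  hence "N dvd \<beta> w - (\<alpha> w + 3 * g w)"
  proof cases
    case 1
    \<comment> \<open>The neighbours differ by 2 s - s/2 = 3 (s/2), so the label s/2 needs no
      choice.\<close>
    have "N dvd dbl s - 4 * half s"
      using dvd_combination[OF half_dvd[of s] dbl_dvd[of s], of "dbl s - 4 * half s" "- 2" 1] by simp
    thus ?thesis using 1 by (simp add: \<alpha>_def \<beta>_def g_def)
  next
    case 2
    thus ?thesis using links(1)[of v] by (simp add: \<alpha>_def \<beta>_def g_def algebra_simps)
  next
    case 3
    thus ?thesis using links(2)[of v] by (simp add: \<alpha>_def \<beta>_def g_def algebra_simps)
  qed
  thus ?thesis by (simp add: cong_iff_dvd_diff)
qed

lemma g_removed: "g ` W \<subseteq> removed S"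
  unfolding W_image g_def removed_def using r_S r'_S by auto

lemma g_inj: "inj_on g W"
proof -
  have half_inj: "half s = half s' \<longleftrightarrow> s = s'" if "s \<in> S" "s' \<in> S" for s s'
    using that dbl_half S_sub by (metis subsetD)
  have hr: "half s \<noteq> r v" "half s \<noteq> r' v" if "s \<in> S" "v \<in> V" for s v
    using that half_S r_S r'_S by blast+
  have rr: "r v \<noteq> r' v'" if "v \<in> V" "v' \<in> V" for v v' using r_disjoint that by blast
  show ?thesis
  proof (rule inj_onI)
    fix w w' assume w: "w \<in> W" "w' \<in> W" and eq: "g w = g w'"
    obtain a k b l where ab: "w = (a, k)" "w' = (b, l)" by (cases w; cases w') auto
    have "k = 0 \<and> a \<in> S \<or> k = 1 \<and> a \<in> V \<or> k = 2 \<and> a \<in> V" "l = 0 \<and> b \<in> S \<or> l = 1 \<and> b \<in> V \<or> l = 2 \<and> b \<in> V"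
      using w ab unfolding W_def by auto
    thus "w = w'" using eq unfolding ab g_def
      by (elim disjE conjE) (simp_all add: hr hr[symmetric] rr rr[symmetric] half_inj
          inj_on_eq_iff[OF r_inj] inj_on_eq_iff[OF r'_inj])
  qed
qed

sublocale base_path N "removed S" W \<alpha> \<beta> g B
proof unfold_locales
  show "removed S \<subseteq> {0<..<N}" using S_sub by (rule removed_range)
  show "N - x \<notin> removed S" if "x \<in> removed S" for x
    using removed_neg[OF that, of "N - x"] by auto
qed (use N_gt coprime_N finite_W g_inj g_removed beta B_ne B_distinct B_set B_edges in auto)

end

text \<open>Here t is the number of orbits and m the number of replaced residues. The terminal
  ending the list needs no detour, whence t - 1; the free m lets card W = m + 2 (t - 1) be
  prescribed.\<close>

lemma ssp_recursion:
  fixes N :: int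
  assumes N: "N > 1" "coprime N 2" "coprime N 3" "coprime N 5" "coprime N 7"
  obtains t where "t \<ge> 1" "\<And>l. l * t \<le> l * 2 ^ (l + 1) + nat N"
    "\<And>m. 3 * (t - 1) \<le> m \<Longrightarrow> int (12 * (t + 2 * m) + 20) < N \<Longrightarrow> 3 \<le> m \<Longrightarrow>
      ssp_Kn (nat N + (m + 2 * (t - 1))) \<le> nat N + 3 * (t + 2 * m) + ssp_Kn (m + 2 * (t - 1))"
proof -
  have "odd N" using N(2) coprime_right_2_iff_odd by blast
  obtain L T where L: "distinct L" "set L = {0<..<N}" "T \<subseteq> {0<..<N}" "last L \<in> T"
    "\<And>x y. (x, y) \<in> steps L \<Longrightarrow> x \<notin> T \<Longrightarrow> y = 2 * x mod N"
    and T: "\<And>t. t \<in> T \<Longrightarrow> N - t \<notin> T" and cT: "\<And>l. l * card T \<le> l * 2 ^ (l + 1) + nat N"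
    using doubling_list[OF \<open>odd N\<close> N(1)] by metis
  interpret terminals N T
  proof
    fix s t assume st: "s \<in> T" "t \<in> T"
    show "\<not> N dvd s + t"
    proof
      assume "N dvd s + t"
      then obtain k where k: "s + t = N * k" by (rule dvdE)
      have rng: "0 < s" "s < N" "0 < t" "t < N" using st L(3) by auto
      have "0 < N * k" "N * k < N * 2" using k rng by linarith+
      hence "0 < k" "k < 2" using N(1) by (auto simp: zero_less_mult_iff)
      hence "k = 1" by linarith
      hence "t = N - s" using k by simp
      thus False using T st by blast
    qed
  qed (use N L(3) in auto)
  define V where "V = T - {last L}"
  have finV: "finite V" unfolding V_def using finite_T by simp
  have cV: "card V = card T - 1" unfolding V_def using finite_T L(4) by simp
  define nx where "nx v = (SOME u. (v, u) \<in> steps L)" for v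
  have nx: "(v, nx v) \<in> steps L" if "v \<in> V" for v
  proof -
    have "v \<in> set L" "v \<noteq> last L" using that L(2,3) unfolding V_def by auto
    thus ?thesis unfolding nx_def using steps_successor by (metis someI_ex)
  qed
  have nx_dvd: "\<forall>v\<in>V. \<not> N dvd nx v - v"
  proof
    fix v assume "v \<in> V"
    hence "(v, nx v) \<in> steps L" by (rule nx)
    hence "v \<noteq> nx v" "v \<in> {0<..<N}" "nx v \<in> {0<..<N}"
      using steps_neq[OF L(1)] steps_in_set L(2) by metis+
    thus "\<not> N dvd nx v - v" using residue_eqI[of "nx v" v] by auto
  qed
  have "ssp_Kn (nat N + (m + 2 * (card T - 1))) \<le> nat N + 3 * (card T + 2 * m) + ssp_Kn (m + 2 * (card T - 1))"
    if m: "3 * (card T - 1) \<le> m" "int (12 * (card T + 2 * m) + 20) < N" "3 \<le> m" for m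
  proof -
    have m': "3 * card V \<le> m" using m(1) cV by simp
    obtain S y r r' where S: "admissible S" "card S = m" "y ` V \<subseteq> S" "r ` V \<subseteq> S" "r' ` V \<subseteq> S"
      "\<forall>v\<in>V. N dvd y v - v - 3 * r v \<and> N dvd nx v - y v - 3 * r' v"
      "inj_on y V" "inj_on r V" "inj_on r' V" "r ` V \<inter> r' ` V = {}"
      by (rule detours_exist[OF finV nx_dvd m' m(2)])
    interpret assembly N T L V S nx y r r'
      by unfold_locales (use L(1,2,4,5) nx S V_def in auto)
    have "card W = m + 2 * (card T - 1)" using card_W S(2) cV by simp
    moreover have "card (removed S) \<le> card T + 2 * m" using card_removed_le[OF finite_S] S(2) by simp
    ultimately show ?thesis using ssp_le_base_path m(3) by simp
  qed
  moreover have "card T \<ge> 1" using finite_T L(4) by (metis One_nat_def Suc_leI card_gt_0_iff empty_iff)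
  ultimately show ?thesis by (intro that[OF _ cT])
qed

section \<open>Asymptotics\<close>

text \<open>w is taken near n / q: large against the number of orbits, which is o(n), and small
  against n.\<close>

lemma ssp_recursive_bound:
  assumes q: "q \<ge> (100::nat)"
  shows "\<exists>n0. \<forall>n\<ge>n0. \<exists>w. q * w \<le> 2 * n \<and> ssp_Kn n \<le> n + 6 * w + ssp_Kn w"
proof -
  define C :: nat where "C = 2 ^ (10 * q + 1)"
  have main: "\<exists>w. q * w \<le> 2 * n \<and> ssp_Kn n \<le> n + 6 * w + ssp_Kn w"
    if n: "n \<ge> q * (1000 + 100 * C)" for n
  proof -
    define a where "a = n div q"
    have a: "a \<ge> 1000 + 100 * C" unfolding a_def using n q by (simp add: less_eq_div_iff_mult_less_eq mult.commute)
    have qa: "q * a \<le> n" unfolding a_def by simp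
    have "100 * a \<le> q * a" using q by simp
    hence na: "100 * a \<le> n" using qa by linarith
    have nq: "n < q * (a + 1)" unfolding a_def using q by (metis Suc_eq_plus1 dividend_less_times_div mult_Suc_right less_le_trans zero_less_numeral add.commute)
    \<comment> \<open>N = 210 j + 1 is coprime to 210, and rounding to this form changes w by a
      bounded amount only.\<close>
    define j where "j = (n - a) div 210"
    define w where "w = n - (210 * j + 1)"
    have j: "210 * j \<le> n - a" "n - a < 210 * j + 210" unfolding j_def by simp_all
    have w: "a - 1 \<le> w" "w \<le> a + 209" "n = (210 * j + 1) + w"
      unfolding w_def using j a na by linarith+
    define N :: int where "N = 210 * int j + 1"
    have cop: "coprime N c" if c: "c dvd 210" for c
    proof -
      obtain d where "210 = c * d" using c by (rule dvdE)
      hence "N = 1 + c * (d * int j)" by (simp add: N_def)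
      hence "d' dvd 1" if "d' dvd N" "d' dvd c" for d'
        using that by (metis dvd_add_left_iff dvd_mult2)
      thus ?thesis by (intro coprimeI)
    qed
    have natN: "nat N = 210 * j + 1" by (simp add: N_def nat_add_distrib nat_mult_distrib)
    have N_gt: "N > 1" using w a na by (simp add: N_def)
    have co: "coprime N 2" "coprime N 3" "coprime N 5" "coprime N 7" by (rule cop; simp)+
    obtain t where t: "t \<ge> 1" "\<And>l. l * t \<le> l * 2 ^ (l + 1) + nat N"
      and rec: "\<And>m. 3 * (t - 1) \<le> m \<Longrightarrow> int (12 * (t + 2 * m) + 20) < N \<Longrightarrow> 3 \<le> m \<Longrightarrow>
        ssp_Kn (nat N + (m + 2 * (t - 1))) \<le> nat N + 3 * (t + 2 * m) + ssp_Kn (m + 2 * (t - 1))"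
      using ssp_recursion[OF N_gt co] by metis
    \<comment> \<open>Orbit bound with l = 10 q: up to a constant, t is at most a / 10, which leaves
      room for 3 (t - 1) <= m.\<close>
    have "q * (10 * t) \<le> 10 * q * C + nat N" using t(2)[of "10 * q"] unfolding C_def by (simp add: mult_ac)
    also have "nat N \<le> n" using natN w(3) by simp
    also have "10 * q * C + n < 10 * q * C + q * (a + 1)" using nq by simp
    also have "\<dots> = q * (10 * C + a + 1)" by (simp add: algebra_simps)
    finally have "10 * t < 10 * C + a + 1" using q by (simp only: mult_less_cancel1)
    hence t': "10 * t \<le> 10 * C + a" by simp
    define m where "m = w - 2 * (t - 1)"
    have m: "w = m + 2 * (t - 1)" "3 * (t - 1) \<le> m" "3 \<le> m"
      unfolding m_def using t' a w(1) by linarith+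
    have "t \<le> a" "m \<le> a + 209" using t' a m(1) w(2) by linarith+
    hence "12 * t + 24 * m + 20 < 210 * j + 1" using w na a by linarith
    hence "12 * (t + 2 * m) + 20 < 210 * j + 1" by simp
    hence "int (12 * (t + 2 * m) + 20) < int (210 * j + 1)" by (simp only: of_nat_less_iff)
    hence "ssp_Kn (nat N + w) \<le> nat N + 3 * (t + 2 * m) + ssp_Kn w"
      using rec[of m] m by (simp add: N_def)
    hence "ssp_Kn n \<le> 210 * j + 1 + 3 * (t + 2 * m) + ssp_Kn w" using natN w(3) by simp
    \<comment> \<open>The slack is the w contained in n = N + w: the claim is 14 <= 11 t + m, with
      equality at t = 1, m = 3.\<close>
    also have "\<dots> \<le> n + 6 * w + ssp_Kn w" using m(1,3) w(3) t(1) by simp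
    finally have "ssp_Kn n \<le> n + 6 * w + ssp_Kn w" .
    moreover have "q * w \<le> 2 * n"
    proof -
      have "q * w \<le> q * (2 * a)" using w(2) a by (intro mult_le_mono2) linarith
      also have "\<dots> = 2 * (q * a)" by simp
      also have "\<dots> \<le> 2 * n" using qa by (rule mult_le_mono2)
      finally show ?thesis .
    qed
    ultimately show ?thesis by blast
  qed
  thus ?thesis by blast
qed

text \<open>Any linear bound is enough to control the recursive term. With q = 100, w is at most n /
  50, so 6 w + 2 w <= n closes the induction.\<close>

lemma ssp_linear_bound: "\<exists>D. \<forall>n. ssp_Kn n \<le> 2 * n + D"
proof -
  obtain n0 where n0: "\<And>n. n \<ge> n0 \<Longrightarrow> \<exists>w. 100 * w \<le> 2 * n \<and> ssp_Kn n \<le> n + 6 * w + ssp_Kn w"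
    using ssp_recursive_bound[of 100] by auto
  define D where "D = (\<Sum>k<Suc n0. ssp_Kn k)"
  have "ssp_Kn n \<le> 2 * n + D" for n
  proof (induction n rule: less_induct)
    case (less n)
    show ?case
    proof (cases "n \<le> n0")
      case True
      hence "ssp_Kn n \<le> D" unfolding D_def by (intro member_le_sum) auto
      thus ?thesis by simp
    next
      case False
      then obtain w where w: "100 * w \<le> 2 * n" "ssp_Kn n \<le> n + 6 * w + ssp_Kn w" using n0[of n] by auto
      hence "w < n" using False by linarith
      hence "ssp_Kn w \<le> 2 * w + D" by (rule less.IH)
      thus ?thesis using w by linarith
    qed
  qed
  thus ?thesis by blast
qed

theorem theorem1p1:
  shows "(\<lambda>n. real (ssp_Kn n)) \<sim>[at_top] (\<lambda>n. real n)"
proof (rule asymp_equivI', rule LIMSEQ_I)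
  fix e :: real assume e: "e > 0"
  obtain D where D: "\<And>n. ssp_Kn n \<le> 2 * n + D" using ssp_linear_bound by blast
  \<comment> \<open>The excess over n is at most 6 w + (2 w + D) with w <= 2 n / q. This q bounds 8
    w by half of e n, and \<open>n1\<close> bounds D + 1 by the other half, the 1 coming from the
    lower bound n - 1.\<close>
  define q where "q = nat \<lceil>32 / e\<rceil> + 100"
  have q: "q \<ge> 100" "16 / real q \<le> e / 2"
  proof -
    show "q \<ge> 100" by (simp add: q_def)
    have "32 / e \<le> real q" unfolding q_def by linarith
    thus "16 / real q \<le> e / 2" using e \<open>q \<ge> 100\<close> by (simp add: field_simps)
  qed
  obtain n0 where n0: "\<And>n. n \<ge> n0 \<Longrightarrow> \<exists>w. q * w \<le> 2 * n \<and> ssp_Kn n \<le> n + 6 * w + ssp_Kn w"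
    using ssp_recursive_bound[OF q(1)] by auto
  define n1 where "n1 = max (max n0 3) (nat \<lceil>2 * (real D + 1) / e\<rceil> + 1)"
  have "norm (real (ssp_Kn n) / real n - 1) < e" if n: "n \<ge> n1" for n
  proof -
    have n': "n \<ge> n0" "n \<ge> 3" "2 * (real D + 1) / e < real n" using n unfolding n1_def by linarith+
    hence De: "real D + 1 < e / 2 * real n" using e by (simp add: field_simps)
    obtain w where w: "q * w \<le> 2 * n" "ssp_Kn n \<le> n + 6 * w + ssp_Kn w" using n0[OF n'(1)] by blast
    have "real (q * w) \<le> real (2 * n)" using w(1) by (simp only: of_nat_le_iff)
    hence "real w \<le> 2 * real n / real q" using q(1) by (simp add: field_simps)
    hence "8 * real w \<le> 16 / real q * real n" by simp
    also have "\<dots> \<le> e / 2 * real n" using q(2) by (intro mult_right_mono) auto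
    finally have w8: "8 * real w \<le> e / 2 * real n" .
    have "ssp_Kn n \<le> n + 8 * w + D" using w(2) D[of w] by linarith
    hence "real (ssp_Kn n) \<le> real n + 8 * real w + real D" by linarith
    hence up: "real (ssp_Kn n) - real n < e * real n" using w8 De by simp
    have "n \<le> ssp_Kn n + 1" using ssp_ge[OF n'(2)] by linarith
    hence "real n \<le> real (ssp_Kn n) + 1" by linarith
    moreover have "e / 2 * real n \<le> e * real n" using e by simp
    ultimately have lo: "real n - real (ssp_Kn n) < e * real n" using De by linarith
    have "real (ssp_Kn n) / real n - 1 = (real (ssp_Kn n) - real n) / real n" using n'(2) by (simp add: field_simps)
    moreover have "\<bar>real (ssp_Kn n) - real n\<bar> < e * real n" using up lo by linarith
    ultimately show ?thesis using n'(2) by (simp add: abs_divide divide_less_eq)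
  qed
  thus "\<exists>no. \<forall>n\<ge>no. norm (real (ssp_Kn n) / real n - 1) < e" by blast
qed

end
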